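(* Let $\Phi=(\phi_n)$ be a Riesz basis for $\mathcal H$, let $\Psi=(\psi_n)$ be a sequence in $\mathcal H$ and $m=(m_n)$ a complex scalar sequence, with $m_n\neq0$, $\phi_n\ne0$, $\psi_n\neq 0$ for all $n$. Then $M_{m,\Phi,\Psi}$ (resp. $M_{m,\Psi,\Phi}$) is invertible on $\mathcal H$ if and only if $m\Psi$ is a Riesz basis for $\mathcal H$. Further, the following holds. (i) If $\Psi$ is a Riesz basis for $\mathcal H$, then $M_{m,\Phi,\Psi}$ (resp. $M_{m,\Psi,\Phi}$) is invertible on $\mathcal H$ if and only if $m$ is $SN$. (ii) If $m$ is $SN$, then $M_{m,\Phi,\Psi}$ (resp. $M_{m,\Psi,\Phi}$) is invertible on $\mathcal H$ if and only if $\Psi$ is a Riesz basis for $\mathcal H$. (iii) If $m$ is not $SN$, then $M_{m,\Phi,\Psi}$ (resp. $M_{m,\Psi,\Phi}$) can be invertible on $\mathcal H$ only in the following cases: $\bullet$ $\Psi$ is non-$NBB$ and Bessel for $\mathcal H$, but not a frame for $\mathcal H$, and $m$ is $NBB$ but not in $\ell^\infty$; $\bullet$ $\Psi$ is non-$NBA$, $NBB$ and non-Bessel for $\mathcal H$, $m$ is non-$NBB$ and $m\in\ell^\infty$; $\bullet$ $\Psi$ is non-$NBA$, non-$NBB$ and non-Bessel for $\mathcal H$, $m$ is non-$NBB$ and $m\notin\ell^\infty$. In the cases of invertibility, $M_{m,\Phi,\Psi}^{-1}=M_{(1),\widetilde{\overline m\Psi},\widetilde\Phi}$ and $M_{m,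\Psi,\Phi}^{-1}=M_{(1),\widetilde\Phi,\widetilde{m\Psi}}$.
   Context: $\mathcal H$ is a separable infinite-dimensional complex Hilbert space, inner product linear in the first argument; all sequences are indexed by $\mathbb N$. For sequences $\Phi=(\phi_n),\Psi=(\psi_n)$ in $\mathcal H$ and a complex sequence $m=(m_n)$, the multiplier is $M_{m,\Phi,\Psi}f=\sum_n m_n\langle f,\psi_n\rangle\phi_n$; it is well defined on $\mathcal H$ if the series converges for every $f\in\mathcal H$. It is invertible on $\mathcal H$ if it is well defined on $\mathcal H$ and has a bounded two-sided inverse $\mathcal H\to\mathcal H$. Notation: $m\Psi=(m_n\psi_n)$, $\overline m=(\overline{m_n})$, $(1)$ is the constant sequence $1$. $\Phi$ is Bessel for $\mathcal H$ with bound $B>0$ if $\sum|\langle h,\phi_n\rangle|^2\le B\|h\|^2$ for all $h\in\mathcal H$. A frame for $\mathcal H$ is a Bessel sequence such that for some $A>0$, $A\|h\|^2\le\sum|\langle h,\phi_n\rangle|^2$ for all $h\in\mathcal H$. A Riesz basis for $\mathcal H$ is a complete sequence in $\mathcal H$ (closed linear span equal to $\mathcal H$) with $A\sum|c_n|^2\le\|\sum c_n\phi_n\|^2\le B\sum|c_n|^2$ for all $(c_n)\in\ell^2$, for some $0<A\le B<\infty$. For a frame $\Phi$ (in particular a Riesz basis), $S_\Phi h=\sum\langle h,\phi_n\rangle\phi_n$ is the (invertible) frame operator and $\widetilde\Phi=(S_\Phi^{-1}\phi_n)$ is the canonical dual. A sequence in $\mathcal H$ is $NBA$ if $\sup_n\|\phi_n\|<\infty$,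 and $NBB$ if $\inf_n\|\phi_n\|>0$; a scalar sequence $m$ is $NBB$ if $\inf_n|m_n|>0$ and $SN$ (semi-normalized) if $0<a\le|m_n|\le b<\infty$ for all $n$ for some constants $a,b$. "Non-" denotes negation. *)

theory Defs
  imports "HOL-Analysis.Analysis"
begin

section \<open>Complex Hilbert spaces\<close>

text \<open>The library has real inner product spaces only. The class below is modelled on
  \<open>real_inner\<close>; completeness is part of \<open>banach\<close>. The inner product is linear in its
  first argument.\<close>

class complex_hilbert_space = banach +
  fixes scaleC :: "complex \<Rightarrow> 'a \<Rightarrow> 'a" (infixr "*\<^sub>C" 75)
    and cinner :: "'a \<Rightarrow> 'a \<Rightarrow> complex"
  assumes scaleC_add_right: "a *\<^sub>C (x + y) = a *\<^sub>C x + a *\<^sub>C y"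
    and scaleC_add_left: "(a + b) *\<^sub>C x = a *\<^sub>C x + b *\<^sub>C x"
    and scaleC_scaleC: "a *\<^sub>C b *\<^sub>C x = (a * b) *\<^sub>C x"
    and scaleR_scaleC: "r *\<^sub>R x = complex_of_real r *\<^sub>C x"
    and cinner_commute: "cinner x y = cnj (cinner y x)"
    and cinner_add_left: "cinner (x + y) z = cinner x z + cinner y z"
    and cinner_scaleC_left: "cinner (a *\<^sub>C x) y = a * cinner x y"
    and cinner_ge_zero: "0 \<le> Re (cinner x x)"
    and cinner_eq_zero_iff: "cinner x x = 0 \<longleftrightarrow> x = 0"
    and norm_eq_sqrt_cinner: "norm x = sqrt (Re (cinner x x))"

lemma scaleC_one: "1 *\<^sub>C x = (x :: 'a :: complex_hilbert_space)"
  using scaleR_scaleC[of 1 x] by simp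

global_interpretation complex_vector:
  vector_space "scaleC :: complex \<Rightarrow> 'a \<Rightarrow> 'a :: complex_hilbert_space"
  defines cspan = complex_vector.span
  by unfold_locales (simp_all add: scaleC_add_right scaleC_add_left scaleC_scaleC scaleC_one)

instantiation complex :: complex_hilbert_space
begin

definition scaleC_complex :: "complex \<Rightarrow> complex \<Rightarrow> complex"
  where "scaleC_complex a x = a * x"

definition cinner_complex :: "complex \<Rightarrow> complex \<Rightarrow> complex"
  where "cinner_complex x y = x * cnj y"

instance
  by standard
    (auto simp: scaleC_complex_def cinner_complex_def algebra_simps scaleR_conv_of_real
      cmod_def power2_eq_square)

end

definition bounded_clinear ::
    "('a::complex_hilbert_space \<Rightarrow> 'b::complex_hilbert_space) \<Rightarrow> bool"
  where "bounded_clinear f \<longleftrightarrow>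
    Vector_Spaces.linear scaleC scaleC f \<and> (\<exists>K. \<forall>x. norm (f x) \<le> norm x * K)"


section \<open>Sequences in a Hilbert space\<close>

definition is_Bessel :: "(nat \<Rightarrow> 'a::complex_hilbert_space) \<Rightarrow> bool"
  where "is_Bessel \<Phi> \<longleftrightarrow> (\<exists>B>0. \<forall>h.
    summable (\<lambda>n. (cmod (cinner h (\<Phi> n)))\<^sup>2) \<and>
    (\<Sum>n. (cmod (cinner h (\<Phi> n)))\<^sup>2) \<le> B * (norm h)\<^sup>2)"

definition is_frame :: "(nat \<Rightarrow> 'a::complex_hilbert_space) \<Rightarrow> bool"
  where "is_frame \<Phi> \<longleftrightarrow> is_Bessel \<Phi> \<and>
    (\<exists>A>0. \<forall>h. A * (norm h)\<^sup>2 \<le> (\<Sum>n. (cmod (cinner h (\<Phi> n)))\<^sup>2))"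

definition is_Riesz_basis :: "(nat \<Rightarrow> 'a::complex_hilbert_space) \<Rightarrow> bool"
  where "is_Riesz_basis \<Phi> \<longleftrightarrow>
    closure (cspan (range \<Phi>)) = UNIV \<and>
    (\<exists>A B. 0 < A \<and> A \<le> B \<and>
      (\<forall>c :: nat \<Rightarrow> complex. summable (\<lambda>n. (cmod (c n))\<^sup>2) \<longrightarrow>
        summable (\<lambda>n. c n *\<^sub>C \<Phi> n) \<and>
        A * (\<Sum>n. (cmod (c n))\<^sup>2) \<le> (norm (\<Sum>n. c n *\<^sub>C \<Phi> n))\<^sup>2 \<and>
        (norm (\<Sum>n. c n *\<^sub>C \<Phi> n))\<^sup>2 \<le> B * (\<Sum>n. (cmod (c n))\<^sup>2)))"

definition frame_operator :: "(nat \<Rightarrow> 'a::complex_hilbert_space) \<Rightarrow> 'a \<Rightarrow> 'a"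
  where "frame_operator \<Phi> h = (\<Sum>n. cinner h (\<Phi> n) *\<^sub>C \<Phi> n)"

text \<open>Meaningful for frames, whose frame operator is bijective.\<close>

definition canonical_dual ::
    "(nat \<Rightarrow> 'a::complex_hilbert_space) \<Rightarrow> nat \<Rightarrow> 'a"
  where "canonical_dual \<Phi> n = inv (frame_operator \<Phi>) (\<Phi> n)"

definition NBA :: "(nat \<Rightarrow> 'a::real_normed_vector) \<Rightarrow> bool"
  where "NBA x \<longleftrightarrow> bdd_above (range (\<lambda>n. norm (x n)))"

definition NBB :: "(nat \<Rightarrow> 'a::real_normed_vector) \<Rightarrow> bool"
  where "NBB x \<longleftrightarrow> 0 < (INF n. norm (x n))"

definition SN :: "(nat \<Rightarrow> complex) \<Rightarrow> bool"
  where "SN m \<longleftrightarrow> (\<exists>a b. 0 < a \<and> (\<forall>n. a \<le> cmod (m n) \<and> cmod (m n) \<le> b))"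

definition ell_infinity :: "(nat \<Rightarrow> complex) set"
  where "ell_infinity = {m. bounded (range m)}"


section \<open>Multipliers\<close>

definition multiplier ::
    "(nat \<Rightarrow> complex) \<Rightarrow> (nat \<Rightarrow> 'a::complex_hilbert_space) \<Rightarrow> (nat \<Rightarrow> 'a) \<Rightarrow> 'a \<Rightarrow> 'a"
  where "multiplier m \<Phi> \<Psi> f = (\<Sum>n. m n *\<^sub>C cinner f (\<Psi> n) *\<^sub>C \<Phi> n)"

definition multiplier_well_defined ::
    "(nat \<Rightarrow> complex) \<Rightarrow> (nat \<Rightarrow> 'a::complex_hilbert_space) \<Rightarrow> (nat \<Rightarrow> 'a) \<Rightarrow> bool"
  where "multiplier_well_defined m \<Phi> \<Psi> \<longleftrightarrow>
    (\<forall>f. summable (\<lambda>n. m n *\<^sub>C cinner f (\<Psi> n) *\<^sub>C \<Phi> n))"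

definition multiplier_invertible ::
    "(nat \<Rightarrow> complex) \<Rightarrow> (nat \<Rightarrow> 'a::complex_hilbert_space) \<Rightarrow> (nat \<Rightarrow> 'a) \<Rightarrow> bool"
  where "multiplier_invertible m \<Phi> \<Psi> \<longleftrightarrow>
    multiplier_well_defined m \<Phi> \<Psi> \<and>
    (\<exists>G. bounded_clinear G \<and>
      (\<forall>f. G (multiplier m \<Phi> \<Psi> f) = f) \<and> (\<forall>f. multiplier m \<Phi> \<Psi> (G f) = f))"

end

theory Submission
  imports Defs
begin

text \<open>Absorbing the weights into \<open>\<Psi>\<close> turns the multiplier into the unweighted composition of
  the analysis along one sequence with the synthesis along the other. For the Riesz basis \<open>\<Phi>\<close>
  both operations are isomorphisms between the space and \<open>\<ell>\<^sup>2\<close>, so the multiplier is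
  invertible exactly when the operation belonging to \<open>m\<Psi>\<close> is an isomorphism too. Well-definedness
  already makes a multiplier bounded, by the uniform boundedness principle, and the inverse is read
  off from the two expansions. The alternatives for \<open>m\<close> not semi-normalized come from
  \<open>\<bar>m n\<bar> * \<parallel>\<Psi> n\<parallel>\<close> being bounded above and away from \<open>0\<close>.\<close>

section \<open>Complex inner products\<close>

text \<open>A weight acts linearly in the synthesis but enters the analysis conjugated, so
  \<open>multiplier m \<Phi> \<Psi>\<close> leads to \<open>cnj (m n)\<close> where the criterion
  has \<open>m n\<close>; the two weighted sequences differ by unimodular factors, which preserve
  Riesz bases. That the analysis reaches every square-summable \<open>c\<close> rests on the inverse
  frame operator: applied to the synthesis of \<open>c\<close>, it gives a vector with exactly the
  coefficients \<open>c\<close>, because the lower Riesz bound makes coefficients unique.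
  Bijectivity of the frame operator therefore has to be settled before any multiplier is inverted.
  When \<open>m\<close> is not semi-normalized, norms tie \<open>NBB \<Psi>\<close> to boundedness
  of \<open>m\<close> but do not decide the Bessel and frame properties. Dividing by weights bounded
  away from 0 yields the Bessel property; the failure of the lower frame bound is detected on the
  biorthogonal sequence.\<close>

lemma cinner_add_right: "cinner x (y + z) = cinner x y + cinner x z"
  by (metis cinner_add_left cinner_commute complex_cnj_add)

lemma cinner_scaleC_right: "cinner x (a *\<^sub>C y) = cnj a * cinner x y"
  by (metis cinner_commute cinner_scaleC_left complex_cnj_mult)

lemma scaleC_scaleR_commute: "a *\<^sub>C (r *\<^sub>R x) = r *\<^sub>R (a *\<^sub>C x)"
  by (simp add: scaleR_scaleC scaleC_scaleC mult.commute)

lemma cinner_self: "cinner x x = complex_of_real ((norm x)\<^sup>2)"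
proof -
  have "Im (cinner x x) = 0"
    using arg_cong[OF cinner_commute[of x x], of Im] by simp
  then show ?thesis
    by (simp add: complex_eq_iff norm_eq_sqrt_cinner cinner_ge_zero)
qed

lemma norm_scaleC: "norm (a *\<^sub>C x) = cmod a * norm x"
proof -
  have "complex_of_real ((norm (a *\<^sub>C x))\<^sup>2) = a * cnj a * cinner x x"
    by (simp only: cinner_self[symmetric] cinner_scaleC_left cinner_scaleC_right mult_ac)
  also have "\<dots> = complex_of_real ((cmod a * norm x)\<^sup>2)"
    by (simp only: cinner_self power_mult_distrib of_real_mult complex_norm_square[of a])
  finally show ?thesis
    unfolding of_real_eq_iff by (metis norm_ge_zero power2_eq_imp_eq zero_le_mult_iff)
qed

lemma norm_cinner_le: "cmod (cinner x y) \<le> norm x * norm y"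
proof (cases "y = 0")
  case True
  then have "cinner x y = 0"
    using cinner_scaleC_right[of x 0 0] by simp
  then show ?thesis by simp
next
  case False
  \<comment> \<open>The coefficient of the orthogonal projection of \<open>x\<close> onto the line
    through \<open>y\<close>; Pythagoras then bounds the projection by \<open>x\<close>.\<close>
  define a where "a = cinner x y / cinner y y"
  have ny: "cinner y y \<noteq> 0" using False by (simp add: cinner_eq_zero_iff)
  have "cinner (x - a *\<^sub>C y) y = 0"
    using cinner_add_left[of "x - a *\<^sub>C y" "a *\<^sub>C y" y] ny
    by (simp add: cinner_scaleC_left a_def)
  then have orth: "cinner (a *\<^sub>C y) (x - a *\<^sub>C y) = 0" "cinner (x - a *\<^sub>C y) (a *\<^sub>C y) = 0"
    by (metis cinner_scaleC_right mult_zero_right cinner_commute complex_cnj_zero)+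
  have "cinner x x = cinner (x - a *\<^sub>C y) (x - a *\<^sub>C y) + cinner (a *\<^sub>C y) (a *\<^sub>C y)"
    using orth cinner_add_left[of "x - a *\<^sub>C y" "a *\<^sub>C y" x]
      cinner_add_right[of "x - a *\<^sub>C y" "x - a *\<^sub>C y" "a *\<^sub>C y"]
      cinner_add_right[of "a *\<^sub>C y" "x - a *\<^sub>C y" "a *\<^sub>C y"]
    by simp
  then have "(norm x)\<^sup>2 = (norm (x - a *\<^sub>C y))\<^sup>2 + (norm (a *\<^sub>C y))\<^sup>2"
    unfolding cinner_self of_real_add[symmetric] of_real_eq_iff .
  then have "(norm (a *\<^sub>C y))\<^sup>2 \<le> (norm x)\<^sup>2" by simp
  then have "norm (a *\<^sub>C y) \<le> norm x"
    by (rule power2_le_imp_le) simp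
  moreover have "norm (a *\<^sub>C y) = cmod (cinner x y) / norm y"
    using False by (simp add: norm_scaleC a_def norm_divide norm_mult cinner_self norm_power power2_eq_square)
  ultimately show ?thesis
    using False by (simp add: field_simps)
qed

lemma bounded_bilinear_cinner: "bounded_bilinear (cinner :: 'a \<Rightarrow> 'a::complex_hilbert_space \<Rightarrow> complex)"
proof
  show "\<exists>K. \<forall>x y :: 'a. norm (cinner x y) \<le> norm x * norm y * K"
    using norm_cinner_le by (metis mult.right_neutral)
qed (simp_all add: cinner_add_left cinner_add_right scaleR_scaleC cinner_scaleC_left
    cinner_scaleC_right scaleC_complex_def)

lemmas bounded_linear_cinner_left = bounded_bilinear.bounded_linear_left[OF bounded_bilinear_cinner]
  and bounded_linear_cinner_right = bounded_bilinear.bounded_linear_right[OF bounded_bilinear_cinner]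

lemma bounded_bilinear_scaleC: "bounded_bilinear (scaleC :: complex \<Rightarrow> 'a \<Rightarrow> 'a::complex_hilbert_space)"
proof
  show "\<exists>K. \<forall>a (x :: 'a). norm (a *\<^sub>C x) \<le> norm a * norm x * K"
    by (intro exI[of _ 1]) (simp add: norm_scaleC)
qed (simp_all add: scaleC_add_left scaleC_add_right scaleC_scaleR_commute
    scaleR_scaleC[of _ "_ *\<^sub>C _"] scaleR_conv_of_real)

lemmas bounded_linear_scaleC_right = bounded_bilinear.bounded_linear_right[OF bounded_bilinear_scaleC]
  and bounded_linear_scaleC_left = bounded_bilinear.bounded_linear_left[OF bounded_bilinear_scaleC]

lemmas cinner_zero_left [simp] = bounded_linear.linear[OF bounded_linear_cinner_left, THEN linear_0]
  and cinner_zero_right [simp] = bounded_linear.linear[OF bounded_linear_cinner_right, THEN linear_0]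
  and cinner_diff_left = bounded_linear.linear[OF bounded_linear_cinner_left, THEN linear_diff]
  and cinner_diff_right = bounded_linear.linear[OF bounded_linear_cinner_right, THEN linear_diff]
  and cinner_sum_right = bounded_linear.linear[OF bounded_linear_cinner_right, THEN linear_sum]

section \<open>Bounded complex-linear maps and uniform boundedness\<close>

lemma bounded_clinearI:
  assumes "\<And>x y. f (x + y) = f x + f y" "\<And>a x. f (a *\<^sub>C x) = a *\<^sub>C f x"
    and "\<And>x. norm (f x) \<le> norm x * K"
  shows "bounded_clinear (f :: 'a::complex_hilbert_space \<Rightarrow> 'b::complex_hilbert_space)"
  unfolding bounded_clinear_def Vector_Spaces.linear_iff
  using assms complex_vector.vector_space_axioms[where 'a = 'a] complex_vector.vector_space_axioms[where 'a = 'b]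
  by auto

lemma bounded_clinear_add: "bounded_clinear f \<Longrightarrow> f (x + y) = f x + f y"
  and bounded_clinear_scaleC: "bounded_clinear f \<Longrightarrow> f (a *\<^sub>C x) = a *\<^sub>C f x"
  by (auto simp: bounded_clinear_def Vector_Spaces.linear_iff)

lemma bounded_clinear_bounded_linear:
  assumes "bounded_clinear f"
  shows "bounded_linear f"
proof -
  obtain K where "\<forall>x. norm (f x) \<le> norm x * K"
    using assms by (auto simp: bounded_clinear_def)
  then show ?thesis
    using assms by (intro bounded_linear_intro[where K = K])
      (simp_all add: bounded_clinear_add scaleR_scaleC bounded_clinear_scaleC)
qed

text \<open>The closed sets on which the whole family is bounded by \<open>k\<close> cover the space, so by Baire
  one of them contains a ball, and differences of points of that ball fill a ball around \<open>0\<close>.\<close>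

lemma Banach_Steinhaus:
  fixes T :: "'i \<Rightarrow> 'a::banach \<Rightarrow> 'b::real_normed_vector"
  assumes lin: "\<And>i. bounded_linear (T i)"
    and bdd: "\<And>x. bounded (range (\<lambda>i. T i x))"
  obtains C where "C > 0" "\<And>i x. norm (T i x) \<le> C * norm x"
proof -
  define E where "E k = (\<Inter>i. {x. norm (T i x) \<le> real k})" for k :: nat
  have closed_E: "closed (E k)" for k
    unfolding E_def
    by (intro closed_INT ballI closed_Collect_le continuous_intros
        bounded_linear.continuous_on[OF lin])
  have cover: "(\<Union>k. E k) = UNIV"
  proof safe
    fix x
    obtain b where "\<And>i. norm (T i x) \<le> b"
      using bdd[of x] unfolding bounded_iff by blast
    moreover obtain k where "b \<le> real k" using real_arch_simple by blast
    ultimately have "x \<in> E k" unfolding E_def by (force intro: order_trans)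
    then show "x \<in> (\<Union>k. E k)" by blast
  qed simp
  have "\<exists>k. interior (E k) \<noteq> {}"
  proof (rule ccontr)
    assume "\<not> ?thesis"
    then have "Met_TC.mtopology interior_of \<Union>(range E) = {}"
      using closed_E
      by (intro Met_TC.metric_Baire_category_alt)
        (auto simp: complete_UNIV)
    then show False using cover by simp
  qed
  then obtain k x0 r where r: "r > 0" and ball: "cball x0 r \<subseteq> E k"
    by (metis all_not_in_conv mem_interior_cball)
  have bound: "norm (T i x) \<le> (2 * real k / r) * norm x" for i x
  proof (cases "x = 0")
    case True
    then show ?thesis using linear_0[OF bounded_linear.linear[OF lin]] by simp
  next
    case False
    interpret T: bounded_linear "T i" by (rule lin)
    define y where "y = (r / norm x) *\<^sub>R x"
    have "x0 \<in> cball x0 r" "x0 + y \<in> cball x0 r"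
      using r False by (auto simp: y_def dist_norm)
    then have "norm (T i x0) \<le> k" "norm (T i (x0 + y)) \<le> k"
      using ball by (auto simp: E_def subset_iff)
    moreover have "T i y = T i (x0 + y) - T i x0" by (simp add: T.add)
    ultimately have "norm (T i y) \<le> 2 * real k"
      using norm_triangle_ineq4[of "T i (x0 + y)" "T i x0"] by simp
    moreover have "norm (T i y) = r / norm x * norm (T i x)"
      using r by (simp add: y_def T.scaleR)
    ultimately show ?thesis using r False by (simp add: field_simps)
  qed
  show ?thesis
  \<comment> \<open>The summand 1 keeps the constant positive even when
    \<open>k = 0\<close>.\<close>
  proof (rule that[of "2 * real k / r + 1"])
    show "2 * real k / r + 1 > 0" using r by (simp add: add_nonneg_pos)
    show "norm (T i x) \<le> (2 * real k / r + 1) * norm x" for i x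
      using bound[of i x] by (simp add: distrib_right add_increasing2)
  qed
qed

section \<open>Bessel sequences and frames\<close>

text \<open>Exposes the constant that \<open>is_Bessel\<close> quantifies away, so that later
  estimates can be stated in terms of it.\<close>

definition Bessel_bound :: "(nat \<Rightarrow> 'a::complex_hilbert_space) \<Rightarrow> real \<Rightarrow> bool"
  where "Bessel_bound \<Phi> B \<longleftrightarrow> 0 < B \<and> (\<forall>h. summable (\<lambda>n. (cmod (cinner h (\<Phi> n)))\<^sup>2) \<and>
    (\<Sum>n. (cmod (cinner h (\<Phi> n)))\<^sup>2) \<le> B * (norm h)\<^sup>2)"

lemma is_Bessel_iff: "is_Bessel \<Phi> \<longleftrightarrow> (\<exists>B. Bessel_bound \<Phi> B)"
  by (simp add: is_Bessel_def Bessel_bound_def)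

lemma Bessel_boundD:
  assumes "Bessel_bound \<Phi> B"
  shows "0 < B" "summable (\<lambda>n. (cmod (cinner h (\<Phi> n)))\<^sup>2)"
    "(\<Sum>n. (cmod (cinner h (\<Phi> n)))\<^sup>2) \<le> B * (norm h)\<^sup>2"
  using assms unfolding Bessel_bound_def by blast+

lemma Bessel_summable: "is_Bessel \<Phi> \<Longrightarrow> summable (\<lambda>n. (cmod (cinner h (\<Phi> n)))\<^sup>2)"
  by (auto simp: is_Bessel_def)

text \<open>The terms are nonnegative, so one uniform bound on partial sums gives both convergence
  and the estimate of the limit.\<close>

lemma is_BesselI_finite:
  assumes "B > 0" and bound: "\<And>h N. (\<Sum>n<N. (cmod (cinner h (\<Phi> n)))\<^sup>2) \<le> B * (norm h)\<^sup>2"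
  shows "is_Bessel \<Phi>"
proof -
  have "summable (\<lambda>n. (cmod (cinner h (\<Phi> n)))\<^sup>2)" for h
    using bound[of h] by (intro bounded_imp_summable[where B = "B * (norm h)\<^sup>2"])
      (auto simp del: sum.lessThan_Suc simp flip: lessThan_Suc_atMost)
  then show ?thesis
    unfolding is_Bessel_def using assms(1)
    by (intro exI[of _ B] conjI allI suminf_le_const bound) auto
qed

lemma is_Bessel_scaleC:
  assumes "is_Bessel \<Phi>" and a: "\<And>n. cmod (a n) \<le> b"
  shows "is_Bessel (\<lambda>n. a n *\<^sub>C \<Phi> n)"
proof -
  obtain B where "Bessel_bound \<Phi> B" using assms(1) unfolding is_Bessel_iff by blast
  note B = Bessel_boundD[OF this]
  have b: "0 \<le> b" using a[of 0] norm_ge_zero order_trans by blast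
  show ?thesis
  proof (rule is_BesselI_finite)
    \<comment> \<open>A Bessel bound must be positive while \<open>b\<close> may be 0, hence the
      added 1.\<close>
    show "(b\<^sup>2 + 1) * B > 0" using B(1) by (simp add: add_nonneg_pos)
    fix h N
    have "(\<Sum>n<N. (cmod (cinner h (a n *\<^sub>C \<Phi> n)))\<^sup>2)
        \<le> (\<Sum>n<N. (b\<^sup>2 + 1) * (cmod (cinner h (\<Phi> n)))\<^sup>2)"
      by (intro sum_mono) (auto simp: cinner_scaleC_right norm_mult power_mult_distrib
          intro!: mult_right_mono add_increasing2 power_mono a)
    also have "\<dots> \<le> (b\<^sup>2 + 1) * (B * (norm h)\<^sup>2)"
      unfolding sum_distrib_left[symmetric]
      using sum_le_suminf[OF B(2), of "{..<N}" h] B(3)[of h]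
      by (intro mult_left_mono) auto
    finally show "(\<Sum>n<N. (cmod (cinner h (a n *\<^sub>C \<Phi> n)))\<^sup>2) \<le> (b\<^sup>2 + 1) * B * (norm h)\<^sup>2"
      by (simp add: mult.assoc)
  qed
qed

text \<open>Meant for \<open>h\<close> equal to the sum itself, when the left side is its squared
  norm. Both the synthesis bound of a Bessel sequence and the lower frame bound of a Riesz basis
  start here.\<close>

lemma cinner_sum_scaleC_le:
  "cmod (cinner h (\<Sum>n\<in>I. c n *\<^sub>C \<Phi> n))
    \<le> sqrt (\<Sum>n\<in>I. (cmod (c n))\<^sup>2) * sqrt (\<Sum>n\<in>I. (cmod (cinner h (\<Phi> n)))\<^sup>2)"
proof -
  have "cmod (cinner h (\<Sum>n\<in>I. c n *\<^sub>C \<Phi> n)) \<le> (\<Sum>n\<in>I. cmod (c n) * cmod (cinner h (\<Phi> n)))"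
    unfolding cinner_sum_right
    by (rule order_trans[OF norm_sum]) (simp add: cinner_scaleC_right norm_mult)
  moreover have "(\<Sum>n\<in>I. cmod (c n) * cmod (cinner h (\<Phi> n)))\<^sup>2
      \<le> (\<Sum>n\<in>I. (cmod (c n))\<^sup>2) * (\<Sum>n\<in>I. (cmod (cinner h (\<Phi> n)))\<^sup>2)"
    by (rule Cauchy_Schwarz_ineq_sum)
  ultimately show ?thesis
    using real_le_rsqrt by (fastforce simp: real_sqrt_mult)
qed

text \<open>Synthesis is the adjoint of analysis and inherits its bound: pairing the sum
  \<open>s\<close> with itself gives \<open>norm s * norm s \<le> sqrt (B * q) * norm s\<close>, and
  one factor cancels.\<close>

lemma Bessel_bound_finite:
  assumes bound: "Bessel_bound \<Phi> B" and "finite I"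
  shows "(norm (\<Sum>n\<in>I. c n *\<^sub>C \<Phi> n))\<^sup>2 \<le> B * (\<Sum>n\<in>I. (cmod (c n))\<^sup>2)"
proof -
  note B = Bessel_boundD[OF bound]
  define s where "s = (\<Sum>n\<in>I. c n *\<^sub>C \<Phi> n)"
  define q where "q = (\<Sum>n\<in>I. (cmod (c n))\<^sup>2)"
  have "(norm s)\<^sup>2 = cmod (cinner s s)" by (simp add: cinner_self norm_power)
  also have "\<dots> \<le> sqrt q * sqrt (\<Sum>n\<in>I. (cmod (cinner s (\<Phi> n)))\<^sup>2)"
    unfolding q_def using cinner_sum_scaleC_le[of s c \<Phi> I] by (simp add: s_def)
  also have "\<dots> \<le> sqrt q * sqrt (B * (norm s)\<^sup>2)"
    using sum_le_suminf[OF B(2) \<open>finite I\<close>, of s] B(3)[of s]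
    by (intro mult_left_mono real_sqrt_le_mono) (auto simp: q_def sum_nonneg)
  finally have le: "norm s * norm s \<le> sqrt (B * q) * norm s"
    by (simp add: real_sqrt_mult power2_eq_square mult_ac)
  have "0 \<le> B * q" using B(1) by (simp add: q_def sum_nonneg)
  moreover have "norm s \<le> sqrt (B * q)"
    using le \<open>0 \<le> B * q\<close> by (cases "norm s = 0") (auto dest: mult_right_le_imp_le)
  ultimately have "(norm s)\<^sup>2 \<le> B * q"
    using power_mono[of "norm s" "sqrt (B * q)" 2] by simp
  then show ?thesis by (simp add: s_def q_def)
qed

text \<open>The finite estimate on blocks of indices makes the partial sums Cauchy; on initial
  segments it passes to the limit.\<close>

lemma
  assumes bound: "Bessel_bound \<Phi> B" and c: "summable (\<lambda>n. (cmod (c n))\<^sup>2)"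
  shows Bessel_bound_summable: "summable (\<lambda>n. c n *\<^sub>C \<Phi> n)" (is ?summable)
    and Bessel_bound_synthesis:
      "(norm (\<Sum>n. c n *\<^sub>C \<Phi> n))\<^sup>2 \<le> B * (\<Sum>n. (cmod (c n))\<^sup>2)" (is ?le)
proof -
  note B = Bessel_boundD(1)[OF bound]
  note fin = Bessel_bound_finite[OF bound]
  show s: ?summable
    unfolding summable_Cauchy
  proof (intro allI impI)
    fix e :: real assume e: "e > 0"
    then have "e\<^sup>2 / B > 0" using B by simp
    then obtain N where N: "\<And>m n. m \<ge> N \<Longrightarrow> norm (\<Sum>k=m..<n. (cmod (c k))\<^sup>2) < e\<^sup>2 / B"
      using c unfolding summable_Cauchy by blast
    have "norm (\<Sum>k=m..<n. c k *\<^sub>C \<Phi> k) < e" if "m \<ge> N" for m n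
    proof -
      have "(norm (\<Sum>k=m..<n. c k *\<^sub>C \<Phi> k))\<^sup>2 \<le> B * (\<Sum>k=m..<n. (cmod (c k))\<^sup>2)"
        by (rule fin) simp
      also have "\<dots> < e\<^sup>2" using N[OF that, of n] B by (simp add: field_simps sum_nonneg)
      finally show ?thesis using e power2_less_imp_less by fastforce
    qed
    then show "\<exists>N. \<forall>m\<ge>N. \<forall>n. norm (\<Sum>k=m..<n. c k *\<^sub>C \<Phi> k) < e" by blast
  qed
  have "(\<lambda>N. (norm (\<Sum>n<N. c n *\<^sub>C \<Phi> n))\<^sup>2) \<longlonglongrightarrow> (norm (\<Sum>n. c n *\<^sub>C \<Phi> n))\<^sup>2"
    by (intro tendsto_intros summable_LIMSEQ s)
  moreover have "(norm (\<Sum>n<N. c n *\<^sub>C \<Phi> n))\<^sup>2 \<le> B * (\<Sum>n. (cmod (c n))\<^sup>2)" for N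
    using fin[of "{..<N}" c] sum_le_suminf[OF c, of "{..<N}"] B
    by (meson finite_lessThan less_imp_le mult_left_mono order_trans zero_le_power2)
  ultimately show ?le
    by (blast intro: LIMSEQ_le_const2)
qed

section \<open>Multipliers and frame operators\<close>

lemma suminf_in_closure_cspan:
  assumes "summable (\<lambda>n. c n *\<^sub>C \<Phi> n)"
  shows "(\<Sum>n. c n *\<^sub>C \<Phi> n) \<in> closure (cspan (range \<Phi>))"
  unfolding closure_sequential
  by (intro exI[of _ "\<lambda>N. \<Sum>n<N. c n *\<^sub>C \<Phi> n"] conjI allI summable_LIMSEQ assms
      complex_vector.span_sum complex_vector.span_scale complex_vector.span_base rangeI)

lemma cinner_suminf_right: "summable x \<Longrightarrow> cinner y (\<Sum>n. x n) = (\<Sum>n. cinner y (x n))"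
  by (rule bounded_linear.suminf[OF bounded_linear_cinner_right])

text \<open>Uniform boundedness is kept at the level of partial sums, not just of their limit: the
  Bessel bound of the second sequence is later extracted from finite sums, before its analysis
  coefficients are known to be square-summable.\<close>

lemma multiplier_partial_sums_bounded:
  assumes "multiplier_well_defined m \<Phi> \<Psi>"
  shows "\<exists>C>0. \<forall>N f. norm (\<Sum>n<N. m n *\<^sub>C cinner f (\<Psi> n) *\<^sub>C \<Phi> n) \<le> C * norm f"
proof -
  have lin: "bounded_linear (\<lambda>f. \<Sum>n<N. m n *\<^sub>C cinner f (\<Psi> n) *\<^sub>C \<Phi> n)" for N
    by (intro bounded_linear_sum bounded_linear_compose[OF bounded_linear_scaleC_right]
        bounded_linear_compose[OF bounded_linear_scaleC_left] bounded_linear_cinner_left)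
  have bdd: "bounded (range (\<lambda>N. \<Sum>n<N. m n *\<^sub>C cinner f (\<Psi> n) *\<^sub>C \<Phi> n))" for f
    using assms unfolding multiplier_well_defined_def
    by (blast intro: convergent_imp_bounded summable_LIMSEQ)
  obtain C where "C > 0"
    "\<And>N f. norm (\<Sum>n<N. m n *\<^sub>C cinner f (\<Psi> n) *\<^sub>C \<Phi> n) \<le> C * norm f"
    by (rule Banach_Steinhaus[of "\<lambda>N f. \<Sum>n<N. m n *\<^sub>C cinner f (\<Psi> n) *\<^sub>C \<Phi> n", OF lin bdd])
      (rule that)
  then show ?thesis by blast
qed

lemma bounded_clinear_multiplier:
  assumes wd: "multiplier_well_defined m \<Phi> \<Psi>"
  shows "bounded_clinear (multiplier m \<Phi> \<Psi>)"
proof -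
  have s: "summable (\<lambda>n. m n *\<^sub>C cinner f (\<Psi> n) *\<^sub>C \<Phi> n)" for f
    using wd unfolding multiplier_well_defined_def by blast
  obtain C where C: "\<And>N f. norm (\<Sum>n<N. m n *\<^sub>C cinner f (\<Psi> n) *\<^sub>C \<Phi> n) \<le> C * norm f"
    using multiplier_partial_sums_bounded[OF wd] by blast
  show ?thesis
  proof (rule bounded_clinearI[where K = C])
    show "multiplier m \<Phi> \<Psi> (x + y) = multiplier m \<Phi> \<Psi> x + multiplier m \<Phi> \<Psi> y" for x y
      unfolding multiplier_def suminf_add[OF s s]
      by (simp only: cinner_add_left scaleC_add_left scaleC_add_right)
    show "multiplier m \<Phi> \<Psi> (a *\<^sub>C x) = a *\<^sub>C multiplier m \<Phi> \<Psi> x" for a x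
      using bounded_linear.suminf[OF bounded_linear_scaleC_right[of a] s[of x]]
      by (simp add: multiplier_def cinner_scaleC_left mult.left_commute)
    fix x
    have "norm (multiplier m \<Phi> \<Psi> x) \<le> C * norm x"
      unfolding multiplier_def using C[of x]
      by (intro LIMSEQ_le_const2[OF tendsto_norm[OF summable_LIMSEQ[OF s[of x]]]]) auto
    then show "norm (multiplier m \<Phi> \<Psi> x) \<le> norm x * C" by (simp add: mult.commute)
  qed
qed

lemma bounded_clinear_norm_le:
  assumes "bounded_clinear f"
  obtains K where "K > 0" "\<And>x. norm (f x) \<le> K * norm x"
  using bounded_linear.pos_bounded[OF bounded_clinear_bounded_linear[OF assms]]
  by (auto simp: mult.commute)

lemma bounded_clinear_inv:
  assumes f: "bounded_clinear f" and bij: "bij f" and le: "\<And>x. norm x \<le> C * norm (f x)"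
  shows "bounded_clinear (inv f)"
proof (rule bounded_clinearI[where K = C])
  show "inv f (x + y) = inv f x + inv f y" for x y
    using bij by (intro inv_f_eq) (simp_all add: bij_is_inj bij_is_surj surj_f_inv_f bounded_clinear_add[OF f])
  show "inv f (a *\<^sub>C x) = a *\<^sub>C inv f x" for a x
    using bij by (intro inv_f_eq) (simp_all add: bij_is_inj bij_is_surj surj_f_inv_f bounded_clinear_scaleC[OF f])
  show "norm (inv f x) \<le> norm x * C" for x
    using le[of "inv f x"] bij by (simp add: bij_is_surj surj_f_inv_f mult.commute)
qed

lemma multiplier_one: "multiplier (\<lambda>_. 1) \<Phi> \<Psi> f = (\<Sum>n. cinner f (\<Psi> n) *\<^sub>C \<Phi> n)"
  by (simp add: multiplier_def)

lemma multiplier_one_well_defined: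
  "multiplier_well_defined (\<lambda>_. 1) \<Phi> \<Psi> \<longleftrightarrow> (\<forall>f. summable (\<lambda>n. cinner f (\<Psi> n) *\<^sub>C \<Phi> n))"
  by (simp add: multiplier_well_defined_def)

lemma Bessel_multiplier_well_defined:
  assumes "is_Bessel \<Phi>" "is_Bessel \<Psi>"
  shows "multiplier_well_defined (\<lambda>_. 1) \<Phi> \<Psi>"
  unfolding multiplier_one_well_defined
  using assms(1) Bessel_bound_summable[OF _ Bessel_summable[OF assms(2)]] unfolding is_Bessel_iff by blast

lemma frame_operator_eq_multiplier: "frame_operator \<Phi> = multiplier (\<lambda>_. 1) \<Phi> \<Phi>"
  by (simp add: fun_eq_iff frame_operator_def multiplier_one)

lemma frame_operator_bounded_clinear: "is_Bessel \<Phi> \<Longrightarrow> bounded_clinear (frame_operator \<Phi>)"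
  unfolding frame_operator_eq_multiplier
  by (intro bounded_clinear_multiplier Bessel_multiplier_well_defined)

text \<open>Exchanging \<open>f\<close> and \<open>g\<close> conjugates the series, which gives
  self-adjointness; \<open>g = f\<close> gives the frame sum as a quadratic form.\<close>

lemma cinner_frame_operator_sums:
  assumes "is_Bessel \<Phi>"
  shows "(\<lambda>n. cinner f (\<Phi> n) * cnj (cinner g (\<Phi> n))) sums cinner (frame_operator \<Phi> f) g"
proof -
  have "(\<lambda>n. cinner f (\<Phi> n) *\<^sub>C \<Phi> n) sums frame_operator \<Phi> f"
    using Bessel_multiplier_well_defined[OF assms assms]
    by (simp add: multiplier_one_well_defined frame_operator_def summable_sums)
  from bounded_linear.sums[OF bounded_linear_cinner_left this, of g]
  show ?thesis by (simp add: cinner_scaleC_left flip: cinner_commute)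
qed

lemma cinner_frame_operator_commute:
  assumes "is_Bessel \<Phi>"
  shows "cinner (frame_operator \<Phi> f) g = cinner f (frame_operator \<Phi> g)"
proof -
  have "(\<lambda>n. cinner f (\<Phi> n) * cnj (cinner g (\<Phi> n))) sums cnj (cinner (frame_operator \<Phi> g) f)"
    using cinner_frame_operator_sums[OF assms, of g f]
    by (subst sums_cnj[symmetric]) (simp add: mult.commute)
  then show ?thesis
    using cinner_frame_operator_sums[OF assms, of f g] sums_unique2
    by (metis cinner_commute)
qed

lemma cinner_frame_operator_self:
  assumes "is_Bessel \<Phi>"
  shows "Re (cinner (frame_operator \<Phi> f) f) = (\<Sum>n. (cmod (cinner f (\<Phi> n)))\<^sup>2)"
  using sums_Re[OF cinner_frame_operator_sums[OF assms, of f f]]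
  by (simp add: sums_iff complex_mult_cnj cmod_power2)

section \<open>Inverting the frame operator\<close>

lemma is_frameE:
  assumes "is_frame \<Phi>"
  obtains A where "A > 0" "\<And>h. A * (norm h)\<^sup>2 \<le> (\<Sum>n. (cmod (cinner h (\<Phi> n)))\<^sup>2)"
  using assms unfolding is_frame_def by blast

lemma frame_Bessel: "is_frame \<Phi> \<Longrightarrow> is_Bessel \<Phi>"
  by (simp add: is_frame_def)

text \<open>With the quadratic form of the operator, the lower frame bound and Cauchy-Schwarz give
  \<open>A * (norm h)\<^sup>2 \<le> norm (frame_operator \<Phi> h) * norm h\<close>. The constant
  obtained is the reciprocal of the frame bound.\<close>

lemma frame_operator_bounded_below:
  assumes "is_frame \<Phi>"
  obtains A where "A > 0" "\<And>h. norm h \<le> A * norm (frame_operator \<Phi> h)"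
proof -
  obtain A where A: "A > 0" "\<And>h. A * (norm h)\<^sup>2 \<le> (\<Sum>n. (cmod (cinner h (\<Phi> n)))\<^sup>2)"
    using is_frameE[OF assms] by blast
  have "norm h \<le> (1 / A) * norm (frame_operator \<Phi> h)" for h
  proof (cases "h = 0")
    case False
    have "A * (norm h)\<^sup>2 \<le> Re (cinner (frame_operator \<Phi> h) h)"
      using A(2) by (simp add: cinner_frame_operator_self frame_Bessel assms)
    also have "\<dots> \<le> norm (frame_operator \<Phi> h) * norm h"
      using complex_Re_le_cmod norm_cinner_le order_trans by blast
    finally show ?thesis using False A(1) by (simp add: power2_eq_square field_simps)
  qed (use A(1) in simp)
  then show ?thesis using A(1) by (intro that[of "1 / A"]) auto
qed

lemma norm_diff_power2: "(norm (x - y))\<^sup>2 = (norm x)\<^sup>2 - 2 * Re (cinner y x) + (norm y)\<^sup>2"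
proof -
  have "cinner (x - y) (x - y) = cinner x x - cinner x y - cinner y x + cinner y y"
    by (simp add: cinner_diff_left cinner_diff_right)
  moreover have "Re (cinner x y) = Re (cinner y x)"
    by (subst cinner_commute) simp
  ultimately have "Re (cinner (x - y) (x - y)) = Re (cinner x x) - 2 * Re (cinner y x) + Re (cinner y y)"
    by simp
  then show ?thesis by (simp add: cinner_self)
qed

text \<open>The relaxed iteration \<open>f \<mapsto> f - (S f - h) / B\<close> is a contraction whose fixed point solves
  \<open>S f = h\<close>, because \<open>\<parallel>S u\<parallel>\<^sup>2 \<le> B \<langle>S u, u\<rangle>\<close>.\<close>

lemma bij_frame_operator:
  assumes "is_frame \<Phi>"
  shows "bij (frame_operator \<Phi>)"
proof (rule bijI)
  let ?S = "frame_operator \<Phi>"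
  have Bes: "is_Bessel \<Phi>" using assms by (rule frame_Bessel)
  interpret S: bounded_linear ?S
    by (intro bounded_clinear_bounded_linear frame_operator_bounded_clinear Bes)
  obtain C where C: "\<And>h. norm h \<le> C * norm (?S h)"
    using frame_operator_bounded_below[OF assms] by blast
  show "inj ?S"
  proof (rule injI)
    fix x y assume "?S x = ?S y"
    then show "x = y" using C[of "x - y"] by (simp add: S.diff)
  qed
  obtain A where A: "A > 0" "\<And>h. A * (norm h)\<^sup>2 \<le> (\<Sum>n. (cmod (cinner h (\<Phi> n)))\<^sup>2)"
    using is_frameE[OF assms] by blast
  obtain B where bound: "Bessel_bound \<Phi> B" using Bes unfolding is_Bessel_iff by blast
  note B = Bessel_boundD(1)[OF bound]
  \<comment> \<open>The maximum covers \<open>A > B\<close>, which the frame inequalities permit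
    only in the zero space; otherwise \<open>q\<^sup>2\<close> is \<open>1 - A / B\<close>.\<close>
  define q where "q = sqrt (max 0 (1 - A / B))"
  have q: "0 \<le> q" "q < 1" using A(1) B by (auto simp: q_def)
  have contr: "norm (u - (1 / B) *\<^sub>R ?S u) \<le> q * norm u" for u
  proof -
    define Q where "Q = (\<Sum>n. (cmod (cinner u (\<Phi> n)))\<^sup>2)"
    have SS: "(norm (?S u))\<^sup>2 \<le> B * Q"
      unfolding frame_operator_def Q_def by (rule Bessel_bound_synthesis[OF bound Bessel_summable[OF Bes]])
    have "(norm (u - (1 / B) *\<^sub>R ?S u))\<^sup>2 = (norm u)\<^sup>2 - 2 / B * Q + (norm (?S u))\<^sup>2 / B\<^sup>2"
      using cinner_frame_operator_self[OF Bes, of u] B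
      by (simp add: norm_diff_power2 Q_def scaleR_scaleC cinner_scaleC_left norm_scaleC
          power_mult_distrib power_divide norm_divide flip: of_real_divide of_real_inverse)
    also have "\<dots> \<le> (norm u)\<^sup>2 - 2 / B * Q + (B * Q) / B\<^sup>2"
      using SS by (intro add_left_mono divide_right_mono) auto
    also have "\<dots> = (norm u)\<^sup>2 - Q / B" using B by (simp add: power2_eq_square field_simps)
    also have "\<dots> \<le> (1 - A / B) * (norm u)\<^sup>2"
      using A(2)[of u] B by (simp add: Q_def field_simps)
    also have "\<dots> \<le> max 0 (1 - A / B) * (norm u)\<^sup>2" by (intro mult_right_mono) auto
    also have "\<dots> = (q * norm u)\<^sup>2" by (simp add: q_def power_mult_distrib)
    finally show ?thesis by (rule power2_le_imp_le) (simp add: q(1))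
  qed
  show "surj ?S"
    unfolding surj_def
  proof
    fix h
    have "\<exists>!x. x - (1 / B) *\<^sub>R (?S x - h) = x"
    proof (rule banach_fix_type[OF q], intro allI)
      fix x y
      have "x - (1 / B) *\<^sub>R (?S x - h) - (y - (1 / B) *\<^sub>R (?S y - h))
          = (x - y) - (1 / B) *\<^sub>R ?S (x - y)"
        by (simp add: S.diff scaleR_diff_right)
      then show "dist (x - (1 / B) *\<^sub>R (?S x - h)) (y - (1 / B) *\<^sub>R (?S y - h)) \<le> q * dist x y"
        using contr[of "x - y"] by (simp only: dist_norm)
    qed
    then obtain x where "x - (1 / B) *\<^sub>R (?S x - h) = x" by blast
    then have "h = ?S x" using B by simp
    then show "\<exists>x. h = ?S x" by blast
  qed
qed

lemma bounded_clinear_inv_frame_operator: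
  assumes "is_frame \<Phi>"
  shows "bounded_clinear (inv (frame_operator \<Phi>))"
  using frame_operator_bounded_below[OF assms] bij_frame_operator[OF assms]
    frame_operator_bounded_clinear[OF frame_Bessel[OF assms]]
  by (metis bounded_clinear_inv)

lemma frame_operator_inv:
  assumes "is_frame \<Phi>"
  shows "frame_operator \<Phi> (inv (frame_operator \<Phi>) h) = h" "inv (frame_operator \<Phi>) (frame_operator \<Phi> h) = h"
  using bij_frame_operator[OF assms] by (simp_all add: bij_is_inj bij_is_surj surj_f_inv_f)

text \<open>Every vector is a value of the surjective frame operator, hence the limit of finite
  combinations.\<close>

lemma frame_complete:
  assumes "is_frame \<Phi>"
  shows "closure (cspan (range \<Phi>)) = UNIV"
proof -
  have "frame_operator \<Phi> f \<in> closure (cspan (range \<Phi>))" for f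
    unfolding frame_operator_def
    using Bessel_multiplier_well_defined[OF frame_Bessel[OF assms] frame_Bessel[OF assms]]
    by (intro suminf_in_closure_cspan) (simp add: multiplier_one_well_defined)
  then show ?thesis
    by (metis UNIV_eq_I frame_operator_inv(1)[OF assms])
qed

text \<open>Self-adjointness moves the inverse frame operator from the dual vector to
  \<open>f\<close>, so analysis along the dual is analysis along \<open>\<Phi>\<close> of a modified
  vector.\<close>

lemma cinner_canonical_dual:
  assumes "is_frame \<Phi>"
  shows "cinner f (canonical_dual \<Phi> n) = cinner (inv (frame_operator \<Phi>) f) (\<Phi> n)"
  using cinner_frame_operator_commute[OF frame_Bessel[OF assms],
      of "inv (frame_operator \<Phi>) f" "canonical_dual \<Phi> n"]
  by (simp add: canonical_dual_def frame_operator_inv[OF assms])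

text \<open>Both inverse frame operators are pulled out of the series, one through the analysis and
  one by continuity. Convergence thus comes from the original Bessel sequences, with no estimate for
  the duals.\<close>

lemma multiplier_canonical_dual:
  assumes \<Phi>: "is_frame \<Phi>" and \<Theta>: "is_frame \<Theta>"
  shows "multiplier_well_defined (\<lambda>_. 1) (canonical_dual \<Theta>) (canonical_dual \<Phi>)" (is ?wd)
    and "multiplier (\<lambda>_. 1) (canonical_dual \<Theta>) (canonical_dual \<Phi>) h =
      inv (frame_operator \<Theta>) (multiplier (\<lambda>_. 1) \<Theta> \<Phi> (inv (frame_operator \<Phi>) h))" (is ?eq)
proof -
  let ?T = "inv (frame_operator \<Theta>)"
  have T: "bounded_clinear ?T" using \<Theta> by (rule bounded_clinear_inv_frame_operator)
  interpret T: bounded_linear ?T using T by (rule bounded_clinear_bounded_linear)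
  have summand: "cinner h (canonical_dual \<Phi> n) *\<^sub>C canonical_dual \<Theta> n
      = ?T (cinner (inv (frame_operator \<Phi>) h) (\<Phi> n) *\<^sub>C \<Theta> n)" for h n
    by (simp add: cinner_canonical_dual[OF \<Phi>] bounded_clinear_scaleC[OF T])
      (simp add: canonical_dual_def)
  have s: "summable (\<lambda>n. cinner f (\<Phi> n) *\<^sub>C \<Theta> n)" for f
    using Bessel_multiplier_well_defined[OF frame_Bessel[OF \<Theta>] frame_Bessel[OF \<Phi>]]
    by (simp add: multiplier_one_well_defined)
  show ?wd
    unfolding multiplier_one_well_defined summand by (intro allI T.summable s)
  show ?eq
    unfolding multiplier_one summand by (rule T.suminf[OF s, symmetric])
qed

section \<open>Riesz bases\<close>

text \<open>In the applications the two bounds come from unrelated sources, so their order is not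
  known; enlarging the upper one to \<open>max A B\<close> restores it.\<close>

lemma is_Riesz_basisI:
  assumes "closure (cspan (range \<Phi>)) = UNIV" "0 < A"
    and "\<And>c. summable (\<lambda>n. (cmod (c n))\<^sup>2) \<Longrightarrow> summable (\<lambda>n. c n *\<^sub>C \<Phi> n)"
    and "\<And>c. summable (\<lambda>n. (cmod (c n))\<^sup>2) \<Longrightarrow>
      A * (\<Sum>n. (cmod (c n))\<^sup>2) \<le> (norm (\<Sum>n. c n *\<^sub>C \<Phi> n))\<^sup>2"
    and B: "\<And>c. summable (\<lambda>n. (cmod (c n))\<^sup>2) \<Longrightarrow>
      (norm (\<Sum>n. c n *\<^sub>C \<Phi> n))\<^sup>2 \<le> B * (\<Sum>n. (cmod (c n))\<^sup>2)"
  shows "is_Riesz_basis \<Phi>"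
proof -
  have "(norm (\<Sum>n. c n *\<^sub>C \<Phi> n))\<^sup>2 \<le> max A B * (\<Sum>n. (cmod (c n))\<^sup>2)"
    if "summable (\<lambda>n. (cmod (c n))\<^sup>2)" for c
    using B[OF that] mult_right_mono[OF max.cobounded2 suminf_nonneg[OF that zero_le_power2], of B A]
    by linarith
  then show ?thesis
    unfolding is_Riesz_basis_def
    by (intro conjI exI[of _ A] exI[of _ "max A B"] allI impI assms(1-4) max.cobounded1)
qed

definition Riesz_bounds :: "(nat \<Rightarrow> 'a::complex_hilbert_space) \<Rightarrow> real \<Rightarrow> real \<Rightarrow> bool"
  where "Riesz_bounds \<Phi> A B \<longleftrightarrow> 0 < A \<and> 0 < B \<and>
    (\<forall>c :: nat \<Rightarrow> complex. summable (\<lambda>n. (cmod (c n))\<^sup>2) \<longrightarrow>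
      summable (\<lambda>n. c n *\<^sub>C \<Phi> n) \<and>
      A * (\<Sum>n. (cmod (c n))\<^sup>2) \<le> (norm (\<Sum>n. c n *\<^sub>C \<Phi> n))\<^sup>2 \<and>
      (norm (\<Sum>n. c n *\<^sub>C \<Phi> n))\<^sup>2 \<le> B * (\<Sum>n. (cmod (c n))\<^sup>2))"

lemma Riesz_basis_bounds:
  assumes "is_Riesz_basis \<Phi>"
  obtains A B where "Riesz_bounds \<Phi> A B"
  using assms less_le_trans unfolding is_Riesz_basis_def Riesz_bounds_def by blast

lemma Riesz_bounds_pos: "Riesz_bounds \<Phi> A B \<Longrightarrow> 0 < A" "Riesz_bounds \<Phi> A B \<Longrightarrow> 0 < B"
  unfolding Riesz_bounds_def by blast+

lemma
  assumes "Riesz_bounds \<Phi> A B" "summable (\<lambda>n. (cmod (c n))\<^sup>2)"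
  shows Riesz_bounds_summable: "summable (\<lambda>n. c n *\<^sub>C \<Phi> n)"
    and Riesz_bounds_lower: "A * (\<Sum>n. (cmod (c n))\<^sup>2) \<le> (norm (\<Sum>n. c n *\<^sub>C \<Phi> n))\<^sup>2"
    and Riesz_bounds_upper: "(norm (\<Sum>n. c n *\<^sub>C \<Phi> n))\<^sup>2 \<le> B * (\<Sum>n. (cmod (c n))\<^sup>2)"
  using assms unfolding Riesz_bounds_def by blast+

lemma Riesz_basis_complete: "is_Riesz_basis \<Phi> \<Longrightarrow> closure (cspan (range \<Phi>)) = UNIV"
  by (simp add: is_Riesz_basis_def)

lemma
  assumes bounds: "Riesz_bounds \<Phi> A B" and I: "finite I"
  shows Riesz_bounds_lower_finite:
      "A * (\<Sum>n\<in>I. (cmod (c n))\<^sup>2) \<le> (norm (\<Sum>n\<in>I. c n *\<^sub>C \<Phi> n))\<^sup>2"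
    and Riesz_bounds_upper_finite:
      "(norm (\<Sum>n\<in>I. c n *\<^sub>C \<Phi> n))\<^sup>2 \<le> B * (\<Sum>n\<in>I. (cmod (c n))\<^sup>2)"
proof -
  \<comment> \<open>Extension by zero turns arbitrary finite data into a square-summable
    sequence.\<close>
  define d where "d n = (if n \<in> I then c n else 0)" for n
  have "(\<lambda>n. (cmod (d n))\<^sup>2) sums (\<Sum>n\<in>I. (cmod (d n))\<^sup>2)"
    and "(\<lambda>n. d n *\<^sub>C \<Phi> n) sums (\<Sum>n\<in>I. d n *\<^sub>C \<Phi> n)"
    by (intro sums_finite I; simp add: d_def)+
  moreover have "(\<Sum>n\<in>I. (cmod (d n))\<^sup>2) = (\<Sum>n\<in>I. (cmod (c n))\<^sup>2)"
    "(\<Sum>n\<in>I. d n *\<^sub>C \<Phi> n) = (\<Sum>n\<in>I. c n *\<^sub>C \<Phi> n)"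
    by (simp_all add: d_def)
  ultimately have q: "(\<lambda>n. (cmod (d n))\<^sup>2) sums (\<Sum>n\<in>I. (cmod (c n))\<^sup>2)"
    and x: "(\<lambda>n. d n *\<^sub>C \<Phi> n) sums (\<Sum>n\<in>I. c n *\<^sub>C \<Phi> n)" by simp_all
  show "A * (\<Sum>n\<in>I. (cmod (c n))\<^sup>2) \<le> (norm (\<Sum>n\<in>I. c n *\<^sub>C \<Phi> n))\<^sup>2"
    and "(norm (\<Sum>n\<in>I. c n *\<^sub>C \<Phi> n))\<^sup>2 \<le> B * (\<Sum>n\<in>I. (cmod (c n))\<^sup>2)"
    using Riesz_bounds_lower[OF bounds sums_summable[OF q]]
      Riesz_bounds_upper[OF bounds sums_summable[OF q]]
    unfolding sums_unique[OF q, symmetric] sums_unique[OF x, symmetric] .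
qed

text \<open>The converse adjoint argument: the synthesis \<open>s\<close> of the coefficients of
  \<open>h\<close> satisfies \<open>cinner h s = q\<close>, so Cauchy-Schwarz and the upper Riesz
  bound give \<open>q * q \<le> B * (norm h)\<^sup>2 * q\<close>, and one \<open>q\<close>
  cancels.\<close>

lemma Riesz_basis_Bessel:
  assumes "is_Riesz_basis \<Phi>"
  shows "is_Bessel \<Phi>"
proof -
  obtain A B where R: "Riesz_bounds \<Phi> A B"
    using assms by (rule Riesz_basis_bounds)
  note B = Riesz_bounds_pos(2)[OF R]
  show ?thesis
  proof (rule is_BesselI_finite[OF B])
    fix h N
    define s where "s = (\<Sum>n<N. cinner h (\<Phi> n) *\<^sub>C \<Phi> n)"
    define q where "q = (\<Sum>n<N. (cmod (cinner h (\<Phi> n)))\<^sup>2)"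
    have "q \<ge> 0" by (simp add: q_def sum_nonneg)
    have "cinner h s = complex_of_real q"
      by (simp add: s_def q_def cinner_sum_right cinner_scaleC_right complex_norm_square mult.commute
          del: of_real_power)
    then have "q \<le> norm h * norm s"
      using norm_cinner_le[of h s] \<open>q \<ge> 0\<close> by simp
    then have "q\<^sup>2 \<le> (norm h)\<^sup>2 * (norm s)\<^sup>2"
      using power_mono[of q "norm h * norm s" 2] \<open>q \<ge> 0\<close> by (simp add: power_mult_distrib)
    also have "\<dots> \<le> (norm h)\<^sup>2 * (B * q)"
      using Riesz_bounds_upper_finite[OF R, of "{..<N}" "\<lambda>n. cinner h (\<Phi> n)"]
      by (intro mult_left_mono) (simp_all add: s_def q_def)
    finally have "q * q \<le> (B * (norm h)\<^sup>2) * q"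
      by (simp add: power2_eq_square mult_ac)
    then show "q \<le> B * (norm h)\<^sup>2"
      using \<open>q \<ge> 0\<close> B by (cases "q = 0") (auto dest: mult_right_le_imp_le)
  qed
qed

lemma cspan_range_finite_sum:
  fixes \<Phi> :: "nat \<Rightarrow> 'a::complex_hilbert_space"
  assumes "x \<in> cspan (range \<Phi>)"
  obtains c N where "x = (\<Sum>n<N. c n *\<^sub>C \<Phi> n)"
proof -
  have "\<exists>c (N :: nat). x = (\<Sum>n<N. c n *\<^sub>C \<Phi> n)"
    using assms
  proof (induction rule: complex_vector.span_induct_alt)
    case base
    show ?case by (rule exI, rule exI[of _ 0]) simp
  next
    case (step a x y)
    then obtain k c N where y: "y = (\<Sum>n<N. c n *\<^sub>C \<Phi> n)" and k: "x = \<Phi> k" by blast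
    \<comment> \<open>\<open>Suc k\<close> brings index \<open>k\<close> into the range. Both
      expansions are padded to this length and their coefficients added, since \<open>k\<close> may
      already occur below \<open>N\<close>.\<close>
    let ?M = "max N (Suc k)"
    have "y = (\<Sum>n<?M. (if n < N then c n else 0) *\<^sub>C \<Phi> n)"
      unfolding y by (intro sum.mono_neutral_cong_left) auto
    moreover have "a *\<^sub>C x = (\<Sum>n<?M. (if n = k then a else 0) *\<^sub>C \<Phi> n)"
      unfolding k by (simp add: if_distrib[of "\<lambda>z. z *\<^sub>C _"] less_max_iff_disj cong: if_cong)
    ultimately show ?case
      by (intro exI[of _ "\<lambda>n. (if n = k then a else 0) + (if n < N then c n else 0)"] exI[of _ ?M])
        (simp only: scaleC_add_left sum.distrib)
  qed
  then show ?thesis using that by blast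
qed

text \<open>On the span, \<open>f\<close> has finitely many coefficients, of square sum
  \<open>q\<close>; then \<open>(norm f)^4 \<le> q * Q\<close> and
  \<open>A * q \<le> (norm f)\<^sup>2\<close> give the lower frame bound, with the constant
  \<open>A\<close> of the Riesz condition. Density extends it to the whole space.\<close>

lemma Riesz_basis_frame:
  assumes "is_Riesz_basis \<Phi>"
  shows "is_frame \<Phi>"
proof -
  have Bes: "is_Bessel \<Phi>" using assms by (rule Riesz_basis_Bessel)
  obtain A B where R: "Riesz_bounds \<Phi> A B"
    using assms by (rule Riesz_basis_bounds)
  note A = Riesz_bounds_pos(1)[OF R]
  \<comment> \<open>The frame sum is written as a quadratic form because continuity of that form,
    and so closedness of the set, is immediate.\<close>
  let ?E = "{f. A * (norm f)\<^sup>2 \<le> Re (cinner (frame_operator \<Phi> f) f)}"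
  have "closed ?E"
    using linear_continuous_on[OF bounded_clinear_bounded_linear[OF frame_operator_bounded_clinear[OF Bes]]]
    by (intro closed_Collect_le continuous_intros bounded_bilinear.continuous_on[OF bounded_bilinear_cinner])
  moreover have "cspan (range \<Phi>) \<subseteq> ?E"
  proof
    fix f assume "f \<in> cspan (range \<Phi>)"
    then obtain c N where f: "f = (\<Sum>n<N. c n *\<^sub>C \<Phi> n)" by (rule cspan_range_finite_sum)
    define Q where "Q = (\<Sum>n. (cmod (cinner f (\<Phi> n)))\<^sup>2)"
    define q where "q = (\<Sum>n<N. (cmod (c n))\<^sup>2)"
    have "0 \<le> q" by (simp add: q_def sum_nonneg)
    have "(norm f)\<^sup>2 = cmod (cinner f f)" by (simp add: cinner_self norm_power)
    also have "\<dots> \<le> sqrt q * sqrt (\<Sum>n<N. (cmod (cinner f (\<Phi> n)))\<^sup>2)"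
      unfolding q_def using cinner_sum_scaleC_le[of f c \<Phi> "{..<N}"] by (simp flip: f)
    also have "\<dots> \<le> sqrt q * sqrt Q"
      unfolding Q_def using \<open>0 \<le> q\<close>
      by (intro mult_left_mono real_sqrt_le_mono sum_le_suminf Bessel_summable[OF Bes]) auto
    finally have "((norm f)\<^sup>2)\<^sup>2 \<le> (sqrt q * sqrt Q)\<^sup>2"
      by (intro power_mono) auto
    also have "\<dots> = q * Q"
      using \<open>0 \<le> q\<close> by (simp add: power_mult_distrib Q_def suminf_nonneg Bessel_summable[OF Bes])
    finally have "A * ((norm f)\<^sup>2)\<^sup>2 \<le> (A * q) * Q" using A by simp
    also have "\<dots> \<le> (norm f)\<^sup>2 * Q"
      using Riesz_bounds_lower_finite[OF R, of "{..<N}" c]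
      by (intro mult_right_mono) (simp_all add: f q_def Q_def suminf_nonneg Bessel_summable[OF Bes])
    finally have *: "(A * (norm f)\<^sup>2) * (norm f)\<^sup>2 \<le> Q * (norm f)\<^sup>2"
      by (simp add: power2_eq_square mult_ac)
    have "A * (norm f)\<^sup>2 \<le> Q"
    proof (cases "f = 0")
      case False
      then show ?thesis using mult_right_le_imp_le[OF *] by simp
    qed (simp add: Q_def)
    then show "f \<in> ?E" by (simp add: cinner_frame_operator_self[OF Bes] Q_def)
  qed
  ultimately have "closure (cspan (range \<Phi>)) \<subseteq> ?E" by (simp add: closure_minimal)
  then have "A * (norm f)\<^sup>2 \<le> (\<Sum>n. (cmod (cinner f (\<Phi> n)))\<^sup>2)" for f
    using Riesz_basis_complete[OF assms] by (auto simp: cinner_frame_operator_self[OF Bes])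
  then show ?thesis using A Bes unfolding is_frame_def by blast
qed

text \<open>The difference of the coefficients is again square-summable and synthesizes to 0, so the
  lower Riesz bound forces it to vanish.\<close>

lemma Riesz_basis_coefficients_unique:
  assumes "is_Riesz_basis \<Phi>"
    and c: "summable (\<lambda>n. (cmod (c n))\<^sup>2)" and d: "summable (\<lambda>n. (cmod (d n))\<^sup>2)"
    and eq: "(\<Sum>n. c n *\<^sub>C \<Phi> n) = (\<Sum>n. d n *\<^sub>C \<Phi> n)"
  shows "c n = d n"
proof -
  obtain A B where R: "Riesz_bounds \<Phi> A B"
    using assms(1) by (rule Riesz_basis_bounds)
  note A = Riesz_bounds_pos(1)[OF R]
  have "norm ((cmod (c n - d n))\<^sup>2) \<le> 2 * (cmod (c n))\<^sup>2 + 2 * (cmod (d n))\<^sup>2" for n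
  proof -
    have "(cmod (c n - d n))\<^sup>2 \<le> (cmod (c n) + cmod (d n))\<^sup>2"
      by (intro power_mono norm_triangle_ineq4) simp
    also have "\<dots> \<le> 2 * (cmod (c n))\<^sup>2 + 2 * (cmod (d n))\<^sup>2"
      using sum_squares_bound[of "cmod (c n)" "cmod (d n)"] by (simp add: power2_sum)
    finally show ?thesis by simp
  qed
  then have s: "summable (\<lambda>n. (cmod (c n - d n))\<^sup>2)"
    using summable_add[OF summable_mult[OF c, of 2] summable_mult[OF d, of 2]]
    by (rule summable_comparison_test'[where N = 0, rotated])
  have "(\<Sum>n. (c n - d n) *\<^sub>C \<Phi> n) = 0"
    unfolding complex_vector.scale_left_diff_distrib
    using suminf_diff[OF Riesz_bounds_summable[OF R c] Riesz_bounds_summable[OF R d]] eq by simp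
  then have "(\<Sum>n. (cmod (c n - d n))\<^sup>2) \<le> 0"
    using Riesz_bounds_lower[OF R s] A by (simp add: mult_le_0_iff)
  moreover have "(cmod (c n - d n))\<^sup>2 \<le> (\<Sum>n. (cmod (c n - d n))\<^sup>2)"
    using sum_le_suminf[OF s, of "{n}"] by simp
  ultimately have "(cmod (c n - d n))\<^sup>2 \<le> 0" by linarith
  then show ?thesis by simp
qed

text \<open>Surjectivity of the analysis onto the square-summable sequences, with an explicit
  preimage: the frame operator expands its value with the coefficients of \<open>f\<close>, and
  these must agree with \<open>c\<close> by uniqueness.\<close>

lemma cinner_inv_frame_operator_synthesis:
  assumes R: "is_Riesz_basis \<Phi>" and c: "summable (\<lambda>n. (cmod (c n))\<^sup>2)"
  shows "cinner (inv (frame_operator \<Phi>) (\<Sum>n. c n *\<^sub>C \<Phi> n)) (\<Phi> k) = c k"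
proof -
  define f where "f = inv (frame_operator \<Phi>) (\<Sum>n. c n *\<^sub>C \<Phi> n)"
  have "frame_operator \<Phi> f = (\<Sum>n. c n *\<^sub>C \<Phi> n)"
    unfolding f_def by (rule frame_operator_inv(1)[OF Riesz_basis_frame[OF R]])
  then show ?thesis
    unfolding f_def[symmetric] frame_operator_def
    by (rule Riesz_basis_coefficients_unique[OF R Bessel_summable[OF Riesz_basis_Bessel[OF R]] c])
qed

text \<open>The preceding identity for the \<open>k\<close>-th unit sequence, whose synthesis is
  \<open>\<Phi> k\<close>.\<close>

lemma cinner_canonical_dual_biorthogonal:
  assumes "is_Riesz_basis \<Phi>"
  shows "cinner (canonical_dual \<Phi> k) (\<Phi> n) = (if n = k then 1 else 0)"
proof -
  let ?e = "\<lambda>n. if n = k then 1 else 0 :: complex"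
  have "(\<lambda>n. ?e n *\<^sub>C \<Phi> n) = (\<lambda>n. if n = k then \<Phi> n else 0)"
    by auto
  then have e: "(\<Sum>n. ?e n *\<^sub>C \<Phi> n) = \<Phi> k"
    using sums_unique[OF sums_single[of k \<Phi>]] by simp
  have "summable (\<lambda>n. (cmod (?e n))\<^sup>2)"
    by (rule summable_finite[of "{k}"]) auto
  from cinner_inv_frame_operator_synthesis[OF assms this, of n] show ?thesis
    unfolding e canonical_dual_def by simp
qed

text \<open>The weights move into the coefficients, changing their square sum by a factor between
  \<open>l\<^sup>2\<close> and \<open>u\<^sup>2\<close>; completeness survives because no weight is
  0.\<close>

lemma Riesz_basis_scaleC:
  assumes R: "is_Riesz_basis \<Phi>" and "SN a"
  shows "is_Riesz_basis (\<lambda>n. a n *\<^sub>C \<Phi> n)"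
proof -
  obtain l u where l: "l > 0" "\<And>n. l \<le> cmod (a n)" and u: "\<And>n. cmod (a n) \<le> u"
    using \<open>SN a\<close> unfolding SN_def by blast
  obtain A B where bounds: "Riesz_bounds \<Phi> A B"
    using R by (rule Riesz_basis_bounds)
  note AB = Riesz_bounds_pos[OF bounds]
  have lo: "l\<^sup>2 * (cmod (c n))\<^sup>2 \<le> (cmod (c n * a n))\<^sup>2"
    and hi: "(cmod (c n * a n))\<^sup>2 \<le> u\<^sup>2 * (cmod (c n))\<^sup>2" for c n
    using mult_right_mono[OF power_mono[OF l(2)[of n], of 2], of "(cmod (c n))\<^sup>2"] l(1)
      mult_right_mono[OF power_mono[OF u[of n], of 2], of "(cmod (c n))\<^sup>2"]
    by (simp_all add: norm_mult power_mult_distrib mult.commute)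
  have s: "summable (\<lambda>n. (cmod (c n * a n))\<^sup>2)" if "summable (\<lambda>n. (cmod (c n))\<^sup>2)" for c
    using hi by (intro summable_comparison_test'[OF summable_mult[OF that]]) auto
  have "a n \<noteq> 0" for n using l(1) l(2)[of n] by auto
  then have "\<Phi> n \<in> cspan (range (\<lambda>n. a n *\<^sub>C \<Phi> n))" for n
    using complex_vector.span_scale[OF complex_vector.span_base[of "a n *\<^sub>C \<Phi> n"
          "range (\<lambda>n. a n *\<^sub>C \<Phi> n)"], of "inverse (a n)"]
    by auto
  then have "cspan (range \<Phi>) \<subseteq> cspan (range (\<lambda>n. a n *\<^sub>C \<Phi> n))"
    by (intro complex_vector.span_minimal) auto
  then have compl: "closure (cspan (range (\<lambda>n. a n *\<^sub>C \<Phi> n))) = UNIV"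
    using closure_mono Riesz_basis_complete[OF R] by blast
  show ?thesis
  proof (rule is_Riesz_basisI[OF compl])
    show "A * l\<^sup>2 > 0" using AB(1) l(1) by simp
    fix c assume c: "summable (\<lambda>n. (cmod (c n))\<^sup>2)"
    show "summable (\<lambda>n. c n *\<^sub>C a n *\<^sub>C \<Phi> n)"
      using Riesz_bounds_summable[OF bounds s[OF c]] by simp
    have "A * (l\<^sup>2 * (\<Sum>n. (cmod (c n))\<^sup>2)) \<le> A * (\<Sum>n. (cmod (c n * a n))\<^sup>2)"
      unfolding suminf_mult[OF c, symmetric]
      using AB(1) by (intro mult_left_mono suminf_le lo summable_mult c s) auto
    also have "\<dots> \<le> (norm (\<Sum>n. (c n * a n) *\<^sub>C \<Phi> n))\<^sup>2" by (rule Riesz_bounds_lower[OF bounds s[OF c]])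
    finally show "A * l\<^sup>2 * (\<Sum>n. (cmod (c n))\<^sup>2) \<le> (norm (\<Sum>n. c n *\<^sub>C a n *\<^sub>C \<Phi> n))\<^sup>2"
      by (simp add: mult.assoc)
    have "(norm (\<Sum>n. (c n * a n) *\<^sub>C \<Phi> n))\<^sup>2 \<le> B * (\<Sum>n. (cmod (c n * a n))\<^sup>2)"
      by (rule Riesz_bounds_upper[OF bounds s[OF c]])
    also have "\<dots> \<le> B * (u\<^sup>2 * (\<Sum>n. (cmod (c n))\<^sup>2))"
      unfolding suminf_mult[OF c, symmetric]
      using AB(2) by (intro mult_left_mono suminf_le hi summable_mult c s) auto
    finally show "(norm (\<Sum>n. c n *\<^sub>C a n *\<^sub>C \<Phi> n))\<^sup>2 \<le> B * u\<^sup>2 * (\<Sum>n. (cmod (c n))\<^sup>2)"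
      by (simp add: mult.assoc)
  qed
qed

lemma Riesz_basis_norm_bounds:
  assumes "is_Riesz_basis \<Phi>"
  shows "\<exists>a b. 0 < a \<and> (\<forall>n. a \<le> norm (\<Phi> n) \<and> norm (\<Phi> n) \<le> b)"
proof -
  obtain A B where R: "Riesz_bounds \<Phi> A B"
    using assms by (rule Riesz_basis_bounds)
  show ?thesis
  proof (intro exI conjI allI)
    show "0 < sqrt A" using Riesz_bounds_pos(1)[OF R] by simp
    show "sqrt A \<le> norm (\<Phi> n)" for n
      using Riesz_bounds_lower_finite[OF R, of "{n}" "\<lambda>_. 1"] by (simp add: real_le_lsqrt)
    show "norm (\<Phi> n) \<le> sqrt B" for n
      using Riesz_bounds_upper_finite[OF R, of "{n}" "\<lambda>_. 1"] by (simp add: real_le_rsqrt)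
  qed
qed

section \<open>Invertible multipliers of Riesz bases\<close>

text \<open>Coefficients are handed from one basis to the other unchanged, after which a frame
  operator cancels its inverse. One composition uses uniqueness of coefficients for
  \<open>\<Theta>\<close>, the other for \<open>\<Phi>\<close>.\<close>

lemma Riesz_basis_multiplier:
  assumes \<Phi>: "is_Riesz_basis \<Phi>" and \<Theta>: "is_Riesz_basis \<Theta>"
  shows Riesz_basis_multiplier_invertible: "multiplier_invertible (\<lambda>_. 1) \<Phi> \<Theta>"
    and Riesz_basis_inv_multiplier:
      "inv (multiplier (\<lambda>_. 1) \<Phi> \<Theta>) = multiplier (\<lambda>_. 1) (canonical_dual \<Theta>) (canonical_dual \<Phi>)"
proof -
  let ?M = "multiplier (\<lambda>_. 1) \<Phi> \<Theta>"
  let ?K = "multiplier (\<lambda>_. 1) (canonical_dual \<Theta>) (canonical_dual \<Phi>)"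
  note F = Riesz_basis_frame[OF \<Phi>] Riesz_basis_frame[OF \<Theta>]
  note Bes = F[THEN frame_Bessel]
  note K_eq = multiplier_canonical_dual(2)[OF F]
  have MK: "?M (?K h) = h" for h
  proof -
    have "cinner (?K h) (\<Theta> n) = cinner (inv (frame_operator \<Phi>) h) (\<Phi> n)" for n
      unfolding K_eq unfolding multiplier_one
      by (rule cinner_inv_frame_operator_synthesis[OF \<Theta> Bessel_summable[OF Bes(1)]])
    then have "?M (?K h) = frame_operator \<Phi> (inv (frame_operator \<Phi>) h)"
      by (simp only: multiplier_one frame_operator_def)
    then show ?thesis by (simp only: frame_operator_inv[OF F(1)])
  qed
  have KM: "?K (?M f) = f" for f
  proof -
    have "cinner (inv (frame_operator \<Phi>) (?M f)) (\<Phi> n) = cinner f (\<Theta> n)" for n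
      unfolding multiplier_one
      by (rule cinner_inv_frame_operator_synthesis[OF \<Phi> Bessel_summable[OF Bes(2)]])
    then have "?K (?M f) = inv (frame_operator \<Theta>) (frame_operator \<Theta> f)"
      unfolding K_eq by (simp only: multiplier_one frame_operator_def)
    then show ?thesis by (simp only: frame_operator_inv[OF F(2)])
  qed
  show "multiplier_invertible (\<lambda>_. 1) \<Phi> \<Theta>"
    unfolding multiplier_invertible_def
    using Bessel_multiplier_well_defined[OF Bes]
      bounded_clinear_multiplier[OF multiplier_canonical_dual(1)[OF F]] MK KM
    by blast
  show "inv ?M = ?K" using KM MK by (rule inv_equality)
qed

lemma multiplier_invertibleE:
  assumes "multiplier_invertible m \<Phi> \<Psi>"
  obtains G K where "multiplier_well_defined m \<Phi> \<Psi>"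
    "\<And>f. G (multiplier m \<Phi> \<Psi> f) = f" "\<And>f. multiplier m \<Phi> \<Psi> (G f) = f"
    "K > 0" "\<And>f. norm (G f) \<le> K * norm f"
proof -
  obtain G where G: "multiplier_well_defined m \<Phi> \<Psi>" "bounded_clinear G"
    "\<And>f. G (multiplier m \<Phi> \<Psi> f) = f" "\<And>f. multiplier m \<Phi> \<Psi> (G f) = f"
    using assms unfolding multiplier_invertible_def by blast
  obtain K where "K > 0" "\<And>f. norm (G f) \<le> K * norm f"
    using bounded_clinear_norm_le[OF G(2)] by blast
  then show ?thesis using that G by blast
qed

text \<open>Boundedness of the multiplier gives the upper bounds and boundedness of its inverse
  \<open>G\<close> the lower ones; in each case \<open>\<Phi>\<close> translates between vectors and
  coefficients.\<close>

lemma Riesz_basis_if_multiplier_invertible_right: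
  assumes \<Phi>: "is_Riesz_basis \<Phi>" and inv: "multiplier_invertible (\<lambda>_. 1) \<Phi> \<Theta>"
  shows "is_Riesz_basis \<Theta>"
proof -
  let ?M = "multiplier (\<lambda>_. 1) \<Phi> \<Theta>"
  obtain A B where R: "Riesz_bounds \<Phi> A B" using \<Phi> by (rule Riesz_basis_bounds)
  note A = Riesz_bounds_pos(1)[OF R] and B = Riesz_bounds_pos(2)[OF R]
  obtain G K where wd: "multiplier_well_defined (\<lambda>_. 1) \<Phi> \<Theta>"
    and GM: "\<And>f. G (?M f) = f" and MG: "\<And>f. ?M (G f) = f"
    and K: "K > 0" "\<And>f. norm (G f) \<le> K * norm f"
    using multiplier_invertibleE[OF inv] by blast
  obtain C where C: "C > 0" "\<And>N f. norm (\<Sum>n<N. cinner f (\<Theta> n) *\<^sub>C \<Phi> n) \<le> C * norm f"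
    using multiplier_partial_sums_bounded[OF wd] by (auto simp: scaleC_one)
  have KB: "K\<^sup>2 * B > 0" using K(1) B by simp
  \<comment> \<open>The lower Riesz bound \<open>A\<close> of \<open>\<Phi>\<close>, applied to the
    partial sums of the multiplier, isolates the coefficients along \<open>\<Theta>\<close>.\<close>
  have Bes: "is_Bessel \<Theta>"
  proof (rule is_BesselI_finite)
    show "C\<^sup>2 / A > 0" using C(1) A by simp
    fix h N
    have "A * (\<Sum>n<N. (cmod (cinner h (\<Theta> n)))\<^sup>2) \<le> (norm (\<Sum>n<N. cinner h (\<Theta> n) *\<^sub>C \<Phi> n))\<^sup>2"
      by (rule Riesz_bounds_lower_finite[OF R]) simp
    also have "\<dots> \<le> (C * norm h)\<^sup>2" by (intro power_mono C) simp
    finally show "(\<Sum>n<N. (cmod (cinner h (\<Theta> n)))\<^sup>2) \<le> C\<^sup>2 / A * (norm h)\<^sup>2"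
      using A by (simp add: field_simps)
  qed
  note l2 = Bessel_summable[OF Bes]
  have G_bound: "(norm (G x))\<^sup>2 \<le> K\<^sup>2 * (norm x)\<^sup>2" for x
    using power_mono[OF K(2)[of x], of 2] by (simp add: power_mult_distrib)
  have G_synthesis: "(norm (G (\<Sum>n. c n *\<^sub>C \<Phi> n)))\<^sup>2 \<le> K\<^sup>2 * B * (\<Sum>n. (cmod (c n))\<^sup>2)"
    if "summable (\<lambda>n. (cmod (c n))\<^sup>2)" for c
    using order_trans[OF G_bound mult_left_mono[OF Riesz_bounds_upper[OF R that]]] by (simp add: mult.assoc)
  have "(norm h)\<^sup>2 \<le> K\<^sup>2 * B * (\<Sum>n. (cmod (cinner h (\<Theta> n)))\<^sup>2)" for h
    using G_synthesis[OF l2[of h]] GM[of h] by (simp add: multiplier_one)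
  then have frame: "is_frame \<Theta>"
    unfolding is_frame_def using Bes KB
    by (intro conjI exI[of _ "1 / (K\<^sup>2 * B)"]) (auto simp: field_simps)
  obtain B' where bound: "Bessel_bound \<Theta> B'" using Bes unfolding is_Bessel_iff by blast
  show ?thesis
  proof (rule is_Riesz_basisI[OF frame_complete[OF frame] _ Bessel_bound_summable[OF bound] _ Bessel_bound_synthesis[OF bound]])
    show "1 / (K\<^sup>2 * B) > 0" using KB by simp
    fix c assume c: "summable (\<lambda>n. (cmod (c n))\<^sup>2)"
    define q where "q = (\<Sum>n. (cmod (c n))\<^sup>2)"
    define x where "x = (\<Sum>n. c n *\<^sub>C \<Theta> n)"
    \<comment> \<open>A vector whose coefficients along \<open>\<Theta>\<close> are the prescribed
      \<open>c\<close>. Pairing it with \<open>x\<close> produces \<open>q\<close>, so a bound on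
      \<open>norm f\<close> bounds \<open>norm x\<close> from below.\<close>
    define f where "f = G (\<Sum>n. c n *\<^sub>C \<Phi> n)"
    have q: "0 \<le> q" unfolding q_def by (intro suminf_nonneg c) simp
    have "(\<Sum>n. cinner f (\<Theta> n) *\<^sub>C \<Phi> n) = (\<Sum>n. c n *\<^sub>C \<Phi> n)"
      using MG[of "\<Sum>n. c n *\<^sub>C \<Phi> n"] by (simp only: f_def multiplier_one)
    then have coeff: "cinner f (\<Theta> n) = c n" for n
      by (rule Riesz_basis_coefficients_unique[OF \<Phi> l2 c])
    have "cinner f x = complex_of_real q"
      unfolding x_def q_def cinner_suminf_right[OF Bessel_bound_summable[OF bound c]] suminf_of_real[OF c]
      by (simp only: cinner_scaleC_right coeff complex_norm_square mult.commute)
    then have "q \<le> norm f * norm x"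
      using norm_cinner_le[of f x] q by simp
    then have "q\<^sup>2 \<le> (norm f)\<^sup>2 * (norm x)\<^sup>2"
      using power_mono[of q "norm f * norm x" 2] q by (simp add: power_mult_distrib)
    also have "\<dots> \<le> (K\<^sup>2 * B * q) * (norm x)\<^sup>2"
      using G_synthesis[OF c] by (intro mult_right_mono) (simp_all add: f_def q_def)
    finally have "q * q \<le> (K\<^sup>2 * B * (norm x)\<^sup>2) * q"
      by (simp add: power2_eq_square mult_ac)
    then have "q \<le> K\<^sup>2 * B * (norm x)\<^sup>2"
      using q KB by (cases "q = 0") (auto dest: mult_right_le_imp_le)
    then show "1 / (K\<^sup>2 * B) * (\<Sum>n. (cmod (c n))\<^sup>2) \<le> (norm (\<Sum>n. c n *\<^sub>C \<Theta> n))\<^sup>2"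
      using KB by (simp add: q_def x_def field_simps)
  qed
qed

text \<open>Every \<open>c\<close> is the coefficient sequence of some \<open>f\<close> along
  \<open>\<Phi>\<close>, and then the multiplier maps \<open>f\<close> to the synthesis of
  \<open>c\<close> along \<open>\<Theta>\<close>. Frame bounds of \<open>\<Phi>\<close> compare
  \<open>c\<close> with \<open>f\<close>; boundedness of the multiplier and of its inverse compares
  \<open>f\<close> with its image.\<close>

lemma Riesz_basis_if_multiplier_invertible_left:
  assumes \<Phi>: "is_Riesz_basis \<Phi>" and inv: "multiplier_invertible (\<lambda>_. 1) \<Theta> \<Phi>"
  shows "is_Riesz_basis \<Theta>"
proof -
  let ?M = "multiplier (\<lambda>_. 1) \<Theta> \<Phi>"
  have frame: "is_frame \<Phi>" using \<Phi> by (rule Riesz_basis_frame)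
  obtain A where A: "A > 0" "\<And>h. A * (norm h)\<^sup>2 \<le> (\<Sum>n. (cmod (cinner h (\<Phi> n)))\<^sup>2)"
    using is_frameE[OF frame] by blast
  obtain B where "Bessel_bound \<Phi> B" using frame_Bessel[OF frame] unfolding is_Bessel_iff by blast
  note B = Bessel_boundD(1,3)[OF this]
  obtain G K where wd: "multiplier_well_defined (\<lambda>_. 1) \<Theta> \<Phi>"
    and GM: "\<And>f. G (?M f) = f" and MG: "\<And>f. ?M (G f) = f"
    and K: "K > 0" "\<And>f. norm (G f) \<le> K * norm f"
    using multiplier_invertibleE[OF inv] by blast
  obtain C where C: "\<And>f. norm (?M f) \<le> C * norm f"
    using bounded_clinear_norm_le[OF bounded_clinear_multiplier[OF wd]] by blast
  have s: "summable (\<lambda>n. cinner f (\<Phi> n) *\<^sub>C \<Theta> n)" for f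
    using wd by (simp add: multiplier_one_well_defined)
  \<comment> \<open>Completeness is surjectivity: \<open>h\<close> is the image of
    \<open>G h\<close>, a series in \<open>\<Theta>\<close>.\<close>
  have "h \<in> closure (cspan (range \<Theta>))" for h
    using suminf_in_closure_cspan[OF s[of "G h"]] MG[of h] by (simp add: multiplier_one)
  then have compl: "closure (cspan (range \<Theta>)) = UNIV" by blast
  show ?thesis
  proof (rule is_Riesz_basisI[OF compl])
    show "1 / (B * K\<^sup>2) > 0" using B(1) K(1) by simp
    fix c assume c: "summable (\<lambda>n. (cmod (c n))\<^sup>2)"
    define f where "f = inv (frame_operator \<Phi>) (\<Sum>n. c n *\<^sub>C \<Phi> n)"
    have coeff: "cinner f (\<Phi> n) = c n" for n
      unfolding f_def by (rule cinner_inv_frame_operator_synthesis[OF \<Phi> c])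
    then have Mf: "?M f = (\<Sum>n. c n *\<^sub>C \<Theta> n)" by (simp only: multiplier_one)
    show "summable (\<lambda>n. c n *\<^sub>C \<Theta> n)" using s[of f] by (simp only: coeff)
    have "(norm f)\<^sup>2 \<le> K\<^sup>2 * (norm (?M f))\<^sup>2"
      using power_mono[OF K(2)[of "?M f"], of 2] by (simp add: GM power_mult_distrib)
    then have "(\<Sum>n. (cmod (c n))\<^sup>2) \<le> B * (K\<^sup>2 * (norm (?M f))\<^sup>2)"
      using order_trans[OF B(2)[of f] mult_left_mono] B(1) by (simp add: coeff)
    then show "1 / (B * K\<^sup>2) * (\<Sum>n. (cmod (c n))\<^sup>2) \<le> (norm (\<Sum>n. c n *\<^sub>C \<Theta> n))\<^sup>2"
      using B(1) K(1) by (simp add: Mf field_simps)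
    have "(norm (?M f))\<^sup>2 \<le> C\<^sup>2 * (norm f)\<^sup>2"
      using power_mono[OF C[of f], of 2] by (simp add: power_mult_distrib)
    also have "\<dots> \<le> C\<^sup>2 * ((\<Sum>n. (cmod (c n))\<^sup>2) / A)"
      using A by (intro mult_left_mono) (simp_all add: coeff[symmetric] field_simps)
    finally show "(norm (\<Sum>n. c n *\<^sub>C \<Theta> n))\<^sup>2 \<le> C\<^sup>2 / A * (\<Sum>n. (cmod (c n))\<^sup>2)"
      by (simp add: Mf)
  qed
qed

section \<open>Weighted Riesz bases\<close>

lemma NBB_iff: "NBB x \<longleftrightarrow> (\<exists>a>0. \<forall>n. a \<le> norm (x n))"
proof
  assume "NBB x"
  then show "\<exists>a>0. \<forall>n. a \<le> norm (x n)"
    unfolding NBB_def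
    by (intro exI[of _ "INF n. norm (x n)"]) (auto intro!: cINF_lower bdd_belowI[of _ 0])
next
  assume "\<exists>a>0. \<forall>n. a \<le> norm (x n)"
  then obtain a where "a > 0" "\<And>n. a \<le> norm (x n)" by blast
  then have "a \<le> (INF n. norm (x n))" by (intro cINF_greatest) auto
  then show "NBB x" using \<open>a > 0\<close> by (simp add: NBB_def)
qed

lemma NBA_iff: "NBA x \<longleftrightarrow> (\<exists>b. \<forall>n. norm (x n) \<le> b)"
  by (auto simp: NBA_def bdd_above_def)

lemma ell_infinity_iff: "m \<in> ell_infinity \<longleftrightarrow> (\<exists>b. \<forall>n. cmod (m n) \<le> b)"
  by (auto simp: ell_infinity_def bounded_iff)

lemma SN_iff: "SN m \<longleftrightarrow> NBB m \<and> m \<in> ell_infinity"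
  unfolding SN_def NBB_iff ell_infinity_iff by blast

lemma SN_inverse:
  assumes "SN m"
  shows "SN (\<lambda>n. inverse (m n))"
proof -
  obtain a b where ab: "0 < a" "\<And>n. a \<le> cmod (m n)" "\<And>n. cmod (m n) \<le> b"
    using assms unfolding SN_def by blast
  have b: "0 < b" using ab(1) ab(2)[of 0] ab(3)[of 0] by linarith
  have "inverse b \<le> cmod (inverse (m n)) \<and> cmod (inverse (m n)) \<le> inverse a" for n
    using ab(1) ab(2,3)[of n] by (auto simp: norm_inverse intro!: le_imp_inverse_le)
  then show ?thesis using b unfolding SN_def by (blast intro: positive_imp_inverse_positive)
qed

text \<open>Test the Bessel inequality at \<open>\<Psi> n\<close> and keep only the
  \<open>n\<close>-th term.\<close>

lemma Bessel_NBA: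
  assumes "is_Bessel \<Psi>"
  shows "NBA \<Psi>"
proof -
  obtain B where "Bessel_bound \<Psi> B" using assms unfolding is_Bessel_iff by blast
  note B = Bessel_boundD[OF this]
  have "norm (\<Psi> n) \<le> sqrt B" for n
  proof (cases "\<Psi> n = 0")
    case False
    have "(cmod (cinner (\<Psi> n) (\<Psi> n)))\<^sup>2 \<le> B * (norm (\<Psi> n))\<^sup>2"
      using sum_le_suminf[OF B(2), of "{n}" "\<Psi> n"] B(3)[of "\<Psi> n"] by simp
    then have "(norm (\<Psi> n))\<^sup>2 * (norm (\<Psi> n))\<^sup>2 \<le> B * (norm (\<Psi> n))\<^sup>2"
      by (simp add: cinner_self norm_mult power2_eq_square)
    then have "(norm (\<Psi> n))\<^sup>2 \<le> B"
      by (rule mult_right_le_imp_le) (simp add: False)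
    then show ?thesis by (rule real_le_rsqrt)
  qed (use B(1) in simp)
  then show ?thesis unfolding NBA_iff by blast
qed

text \<open>The quotients \<open>m n / cnj (m n)\<close> have modulus 1 and are thus
  semi-normalized, however \<open>m\<close> itself behaves.\<close>

lemma Riesz_basis_cnj_scaleC_iff:
  assumes "\<And>n. m n \<noteq> 0"
  shows "is_Riesz_basis (\<lambda>n. cnj (m n) *\<^sub>C \<Psi> n) \<longleftrightarrow> is_Riesz_basis (\<lambda>n. m n *\<^sub>C \<Psi> n)"
proof
  have SN: "SN (\<lambda>n. m n / cnj (m n))" "SN (\<lambda>n. cnj (m n) / m n)"
    using assms by (auto simp: SN_def norm_divide intro!: exI[of _ 1])
  show "is_Riesz_basis (\<lambda>n. m n *\<^sub>C \<Psi> n)" if "is_Riesz_basis (\<lambda>n. cnj (m n) *\<^sub>C \<Psi> n)"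
    using Riesz_basis_scaleC[OF that SN(1)] assms by simp
  show "is_Riesz_basis (\<lambda>n. cnj (m n) *\<^sub>C \<Psi> n)" if "is_Riesz_basis (\<lambda>n. m n *\<^sub>C \<Psi> n)"
    using Riesz_basis_scaleC[OF that SN(2)] assms by simp
qed

text \<open>The sequence biorthogonal to \<open>m\<Psi>\<close> has norms bounded away from \<open>0\<close>, and its \<open>k\<close>-th member
  has the single nonzero coefficient \<open>1 / cnj (m k)\<close> with respect to \<open>\<Psi>\<close>.\<close>

lemma ell_infinity_if_frame:
  assumes \<Theta>: "is_Riesz_basis (\<lambda>n. m n *\<^sub>C \<Psi> n)" and m: "\<And>n. m n \<noteq> 0" and "is_frame \<Psi>"
  shows "m \<in> ell_infinity"
proof -
  obtain A where A: "A > 0" "\<And>h. A * (norm h)\<^sup>2 \<le> (\<Sum>n. (cmod (cinner h (\<Psi> n)))\<^sup>2)"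
    using is_frameE[OF assms(3)] by blast
  obtain b where b: "\<And>n. norm (m n *\<^sub>C \<Psi> n) \<le> b"
    using Riesz_basis_norm_bounds[OF \<Theta>] by blast
  have "cmod (m k) \<le> b / sqrt A" for k
  proof -
    define g where "g = canonical_dual (\<lambda>n. m n *\<^sub>C \<Psi> n) k"
    have g: "cinner g (m n *\<^sub>C \<Psi> n) = (if n = k then 1 else 0)" for n
      unfolding g_def by (rule cinner_canonical_dual_biorthogonal[OF \<Theta>])
    have "cinner g (\<Psi> n) = (if n = k then 1 / cnj (m k) else 0)" for n
      using g[of n] m[of n] by (auto simp: cinner_scaleC_right field_simps split: if_splits)
    then have "(\<lambda>n. (cmod (cinner g (\<Psi> n)))\<^sup>2) = (\<lambda>n. if n = k then 1 / (cmod (m k))\<^sup>2 else 0)"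
      by (auto simp: norm_divide power_divide)
    then have "(\<Sum>n. (cmod (cinner g (\<Psi> n)))\<^sup>2) = 1 / (cmod (m k))\<^sup>2"
      using sums_unique[OF sums_single[of k "\<lambda>_. 1 / (cmod (m k))\<^sup>2"]] by simp
    then have "A * (norm g)\<^sup>2 \<le> 1 / (cmod (m k))\<^sup>2"
      using A(2)[of g] by simp
    then have "A * (norm g)\<^sup>2 * (cmod (m k))\<^sup>2 \<le> 1"
      using m[of k] by (simp add: pos_le_divide_eq)
    then have "(sqrt A * norm g * cmod (m k))\<^sup>2 \<le> 1\<^sup>2"
      using A(1) by (simp add: power_mult_distrib)
    then have le1: "sqrt A * cmod (m k) * norm g \<le> 1"
      using power2_le_imp_le[of "sqrt A * norm g * cmod (m k)" 1] by (simp add: mult_ac)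
    \<comment> \<open>The lower bound on \<open>norm g\<close>: its pairing with
      \<open>m k *\<^sub>C \<Psi> k\<close>, a vector of norm at most \<open>b\<close>, is
      1.\<close>
    have "1 \<le> norm g * b"
      using norm_cinner_le[of g "m k *\<^sub>C \<Psi> k"] g[of k] mult_left_mono[OF b[of k], of "norm g"] by simp
    then have "sqrt A * cmod (m k) * 1 \<le> sqrt A * cmod (m k) * (norm g * b)"
      using A(1) by (intro mult_left_mono) auto
    also have "\<dots> \<le> 1 * b"
      using mult_right_mono[OF le1, of b] order_trans[OF norm_ge_zero b[of k]] by (simp add: mult_ac)
    finally show ?thesis using A(1) by (simp add: field_simps)
  qed
  then show ?thesis unfolding ell_infinity_iff by blast
qed

lemma multiplier_weight_right: "multiplier m \<Phi> \<Psi> = multiplier (\<lambda>_. 1) \<Phi> (\<lambda>n. cnj (m n) *\<^sub>C \<Psi> n)"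
    and multiplier_invertible_weight_right: "multiplier_invertible m \<Phi> \<Psi> \<longleftrightarrow>
      multiplier_invertible (\<lambda>_. 1) \<Phi> (\<lambda>n. cnj (m n) *\<^sub>C \<Psi> n)"
  by (simp_all add: multiplier_invertible_def multiplier_well_defined_def multiplier_def
      cinner_scaleC_right fun_eq_iff)

lemma multiplier_weight_left: "multiplier m \<Psi> \<Phi> = multiplier (\<lambda>_. 1) (\<lambda>n. m n *\<^sub>C \<Psi> n) \<Phi>"
    and multiplier_invertible_weight_left: "multiplier_invertible m \<Psi> \<Phi> \<longleftrightarrow>
      multiplier_invertible (\<lambda>_. 1) (\<lambda>n. m n *\<^sub>C \<Psi> n) \<Phi>"
  by (simp_all add: multiplier_invertible_def multiplier_well_defined_def multiplier_def
      fun_eq_iff mult.commute)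

lemma multiplier_invertible_iff_Riesz_basis:
  assumes "is_Riesz_basis \<Phi>"
  shows "multiplier_invertible (\<lambda>_. 1) \<Phi> \<Theta> \<longleftrightarrow> is_Riesz_basis \<Theta>"
    and "multiplier_invertible (\<lambda>_. 1) \<Theta> \<Phi> \<longleftrightarrow> is_Riesz_basis \<Theta>"
  using Riesz_basis_if_multiplier_invertible_right[OF assms]
    Riesz_basis_if_multiplier_invertible_left[OF assms]
    Riesz_basis_multiplier_invertible assms by blast+

text \<open>Necessity is read off from norms: those of both sequences lie between positive
  constants, hence so do their quotients \<open>cmod (m n)\<close>.\<close>

lemma Riesz_basis_weight_SN:
  assumes "is_Riesz_basis \<Psi>"
  shows "is_Riesz_basis (\<lambda>n. m n *\<^sub>C \<Psi> n) \<longleftrightarrow> SN m"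
proof
  assume "is_Riesz_basis (\<lambda>n. m n *\<^sub>C \<Psi> n)"
  then obtain a b where a: "0 < a"
    and ab: "\<And>n. a \<le> norm (m n *\<^sub>C \<Psi> n)" "\<And>n. norm (m n *\<^sub>C \<Psi> n) \<le> b"
    using Riesz_basis_norm_bounds by blast
  obtain c d where c: "0 < c" and cd: "\<And>n. c \<le> norm (\<Psi> n)" "\<And>n. norm (\<Psi> n) \<le> d"
    using Riesz_basis_norm_bounds[OF assms] by blast
  have d: "0 < d" using c cd(1)[of 0] cd(2)[of 0] by linarith
  have "a / d \<le> cmod (m n) \<and> cmod (m n) \<le> b / c" for n
  proof
    have "a \<le> cmod (m n) * d"
      using ab(1)[of n] mult_left_mono[OF cd(2)[of n], of "cmod (m n)"] by (simp add: norm_scaleC)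
    then show "a / d \<le> cmod (m n)" using d by (simp add: pos_divide_le_eq)
    have "cmod (m n) * c \<le> b"
      using ab(2)[of n] mult_left_mono[OF cd(1)[of n], of "cmod (m n)"] by (simp add: norm_scaleC)
    then show "cmod (m n) \<le> b / c" using c by (simp add: pos_le_divide_eq)
  qed
  then show "SN m" unfolding SN_def using a d by (intro exI[of _ "a / d"] exI[of _ "b / c"]) simp
next
  assume "SN m"
  with assms show "is_Riesz_basis (\<lambda>n. m n *\<^sub>C \<Psi> n)" by (rule Riesz_basis_scaleC)
qed

lemma Riesz_basis_SN_weight:
  assumes "SN m"
  shows "is_Riesz_basis (\<lambda>n. m n *\<^sub>C \<Psi> n) \<longleftrightarrow> is_Riesz_basis \<Psi>"
proof
  assume R: "is_Riesz_basis (\<lambda>n. m n *\<^sub>C \<Psi> n)"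
  have "m n \<noteq> 0" for n
    using assms unfolding SN_def by (metis norm_zero not_less)
  then show "is_Riesz_basis \<Psi>" using Riesz_basis_scaleC[OF R SN_inverse[OF assms]] by simp
next
  assume "is_Riesz_basis \<Psi>"
  then show "is_Riesz_basis (\<lambda>n. m n *\<^sub>C \<Psi> n)" using assms by (rule Riesz_basis_scaleC)
qed

text \<open>If \<open>NBB m\<close>, then \<open>m\<close> is unbounded, so \<open>\<Psi>\<close> is
  non-NBB; it is Bessel after dividing by the weights, and a frame would bound \<open>m\<close>. If
  not \<open>NBB m\<close>, then \<open>\<Psi>\<close> is non-NBA and hence non-Bessel, and
  boundedness of \<open>m\<close>, equivalent to \<open>NBB \<Psi>\<close>, separates the other two
  cases.\<close>

lemma Riesz_basis_weight_cases:
  assumes \<Theta>: "is_Riesz_basis (\<lambda>n. m n *\<^sub>C \<Psi> n)" and m: "\<And>n. m n \<noteq> 0" and "\<not> SN m"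
  shows "(\<not> NBB \<Psi> \<and> is_Bessel \<Psi> \<and> \<not> is_frame \<Psi> \<and> NBB m \<and> m \<notin> ell_infinity) \<or>
    (\<not> NBA \<Psi> \<and> NBB \<Psi> \<and> \<not> is_Bessel \<Psi> \<and> \<not> NBB m \<and> m \<in> ell_infinity) \<or>
    (\<not> NBA \<Psi> \<and> \<not> NBB \<Psi> \<and> \<not> is_Bessel \<Psi> \<and> \<not> NBB m \<and> m \<notin> ell_infinity)"
proof -
  obtain a b where a: "0 < a"
    and ab: "\<And>n. a \<le> cmod (m n) * norm (\<Psi> n)" "\<And>n. cmod (m n) * norm (\<Psi> n) \<le> b"
    using Riesz_basis_norm_bounds[OF \<Theta>] unfolding norm_scaleC by blast
  have 1: "m \<in> ell_infinity" if asm: "NBB \<Psi>"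
  proof -
    obtain c where c: "c > 0" "\<And>n. c \<le> norm (\<Psi> n)" using asm by (auto simp: NBB_iff)
    have "cmod (m n) \<le> b / c" for n
      using mult_left_mono[OF c(2)[of n], of "cmod (m n)"] ab(2)[of n] c(1)
      by (simp add: pos_le_divide_eq)
    then show ?thesis unfolding ell_infinity_iff by blast
  qed
  have 2: "NBB \<Psi>" if asm: "m \<in> ell_infinity"
  proof -
    obtain c where c: "\<And>n. cmod (m n) \<le> c" using asm by (auto simp: ell_infinity_iff)
    have c0: "0 < c" using c[of 0] m[of 0] by (meson less_le_trans zero_less_norm_iff)
    have "a / c \<le> norm (\<Psi> n)" for n
      using mult_right_mono[OF c[of n], of "norm (\<Psi> n)"] ab(1)[of n] c0
      by (simp add: pos_divide_le_eq mult.commute)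
    then show ?thesis using a c0 unfolding NBB_iff by (intro exI[of _ "a / c"]) simp
  qed
  have 3: "NBB m" if asm: "NBA \<Psi>"
  proof -
    obtain d where d: "\<And>n. norm (\<Psi> n) \<le> d" using asm by (auto simp: NBA_iff)
    have "0 < norm (\<Psi> 0)" using a ab(1)[of 0] by auto
    then have d0: "0 < d" using d[of 0] by linarith
    have "a / d \<le> cmod (m n)" for n
      using mult_left_mono[OF d[of n], of "cmod (m n)"] ab(1)[of n] d0
      by (simp add: pos_divide_le_eq)
    then show ?thesis using a d0 unfolding NBB_iff by (intro exI[of _ "a / d"]) simp
  qed
  have 4: "is_Bessel \<Psi>" if asm: "NBB m"
  proof -
    obtain c where c: "c > 0" "\<And>n. c \<le> cmod (m n)" using asm by (auto simp: NBB_iff)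
    have "cmod (inverse (m n)) \<le> inverse c" for n
      using c by (auto simp: norm_inverse intro!: le_imp_inverse_le)
    from is_Bessel_scaleC[OF Riesz_basis_Bessel[OF \<Theta>], of "\<lambda>n. inverse (m n)", OF this]
    show ?thesis using m by simp
  qed
  show ?thesis
    using 1 2 3 4 Bessel_NBA ell_infinity_if_frame[OF \<Theta> m] assms(3) unfolding SN_iff by blast
qed

text \<open>\<open>inv\<close>, \<open>canonical_dual\<close> and \<open>multiplier\<close> are
  total functions; the frame and well-definedness conjuncts record that the inverse formulas use
  them where they are meaningful.\<close>

theorem corollary4p12:
  fixes \<Phi> \<Psi> :: "nat \<Rightarrow> 'a::complex_hilbert_space"
    and m :: "nat \<Rightarrow> complex"
  assumes separable: "separable_space (euclidean :: 'a topology)"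
    and infinite_dimensional: "\<nexists>B :: 'a set. finite B \<and> cspan B = UNIV"
    and Riesz: "is_Riesz_basis \<Phi>"
    and m_nonzero: "\<And>n. m n \<noteq> 0"
    and Phi_nonzero: "\<And>n. \<Phi> n \<noteq> 0"
    and Psi_nonzero: "\<And>n. \<Psi> n \<noteq> 0"
  shows
    "(multiplier_invertible m \<Phi> \<Psi> \<longleftrightarrow> is_Riesz_basis (\<lambda>n. m n *\<^sub>C \<Psi> n)) \<and>
     (multiplier_invertible m \<Psi> \<Phi> \<longleftrightarrow> is_Riesz_basis (\<lambda>n. m n *\<^sub>C \<Psi> n)) \<and>
     (is_Riesz_basis \<Psi> \<longrightarrow>
        (multiplier_invertible m \<Phi> \<Psi> \<longleftrightarrow> SN m) \<and>
        (multiplier_invertible m \<Psi> \<Phi> \<longleftrightarrow> SN m)) \<and>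
     (SN m \<longrightarrow>
        (multiplier_invertible m \<Phi> \<Psi> \<longleftrightarrow> is_Riesz_basis \<Psi>) \<and>
        (multiplier_invertible m \<Psi> \<Phi> \<longleftrightarrow> is_Riesz_basis \<Psi>)) \<and>
     (\<not> SN m \<longrightarrow>
        multiplier_invertible m \<Phi> \<Psi> \<or> multiplier_invertible m \<Psi> \<Phi> \<longrightarrow>
          (\<not> NBB \<Psi> \<and> is_Bessel \<Psi> \<and> \<not> is_frame \<Psi> \<and> NBB m \<and> m \<notin> ell_infinity) \<or>
          (\<not> NBA \<Psi> \<and> NBB \<Psi> \<and> \<not> is_Bessel \<Psi> \<and> \<not> NBB m \<and> m \<in> ell_infinity) \<or>
          (\<not> NBA \<Psi> \<and> \<not> NBB \<Psi> \<and> \<not> is_Bessel \<Psi> \<and> \<not> NBB m \<and> m \<notin> ell_infinity)) \<and>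
     (multiplier_invertible m \<Phi> \<Psi> \<longrightarrow>
        is_frame \<Phi> \<and> is_frame (\<lambda>n. cnj (m n) *\<^sub>C \<Psi> n) \<and>
        multiplier_well_defined (\<lambda>_. 1)
          (canonical_dual (\<lambda>n. cnj (m n) *\<^sub>C \<Psi> n)) (canonical_dual \<Phi>) \<and>
        inv (multiplier m \<Phi> \<Psi>) =
          multiplier (\<lambda>_. 1) (canonical_dual (\<lambda>n. cnj (m n) *\<^sub>C \<Psi> n)) (canonical_dual \<Phi>)) \<and>
     (multiplier_invertible m \<Psi> \<Phi> \<longrightarrow>
        is_frame \<Phi> \<and> is_frame (\<lambda>n. m n *\<^sub>C \<Psi> n) \<and>
        multiplier_well_defined (\<lambda>_. 1)
          (canonical_dual \<Phi>) (canonical_dual (\<lambda>n. m n *\<^sub>C \<Psi> n)) \<and>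
        inv (multiplier m \<Psi> \<Phi>) =
          multiplier (\<lambda>_. 1) (canonical_dual \<Phi>) (canonical_dual (\<lambda>n. m n *\<^sub>C \<Psi> n)))"
proof -
  let ?\<Theta> = "\<lambda>n. m n *\<^sub>C \<Psi> n" and ?\<Theta>' = "\<lambda>n. cnj (m n) *\<^sub>C \<Psi> n"
  have right: "multiplier_invertible m \<Phi> \<Psi> \<longleftrightarrow> is_Riesz_basis ?\<Theta>"
    unfolding multiplier_invertible_weight_right[of m]
    by (simp only: multiplier_invertible_iff_Riesz_basis[OF Riesz] Riesz_basis_cnj_scaleC_iff[of m, OF m_nonzero])
  have left: "multiplier_invertible m \<Psi> \<Phi> \<longleftrightarrow> is_Riesz_basis ?\<Theta>"
    unfolding multiplier_invertible_weight_left[of m]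
    by (rule multiplier_invertible_iff_Riesz_basis[OF Riesz])
  have frame: "is_frame \<Phi>" using Riesz by (rule Riesz_basis_frame)
  have right_inverse: "is_frame \<Phi> \<and> is_frame ?\<Theta>' \<and>
      multiplier_well_defined (\<lambda>_. 1) (canonical_dual ?\<Theta>') (canonical_dual \<Phi>) \<and>
      inv (multiplier m \<Phi> \<Psi>) = multiplier (\<lambda>_. 1) (canonical_dual ?\<Theta>') (canonical_dual \<Phi>)"
    if "multiplier_invertible m \<Phi> \<Psi>"
  proof -
    have \<Theta>': "is_Riesz_basis ?\<Theta>'"
      using that by (simp only: right Riesz_basis_cnj_scaleC_iff[of m, OF m_nonzero])
    show ?thesis
      unfolding multiplier_weight_right[of m]
      by (intro conjI frame Riesz_basis_frame[OF \<Theta>'] multiplier_canonical_dual(1)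
          Riesz_basis_inv_multiplier[OF Riesz \<Theta>'])
  qed
  have left_inverse: "is_frame \<Phi> \<and> is_frame ?\<Theta> \<and>
      multiplier_well_defined (\<lambda>_. 1) (canonical_dual \<Phi>) (canonical_dual ?\<Theta>) \<and>
      inv (multiplier m \<Psi> \<Phi>) = multiplier (\<lambda>_. 1) (canonical_dual \<Phi>) (canonical_dual ?\<Theta>)"
    if "multiplier_invertible m \<Psi> \<Phi>"
  proof -
    have \<Theta>: "is_Riesz_basis ?\<Theta>" using that by (simp only: left)
    show ?thesis
      unfolding multiplier_weight_left[of m]
      by (intro conjI frame Riesz_basis_frame[OF \<Theta>] multiplier_canonical_dual(1)
          Riesz_basis_inv_multiplier[OF \<Theta> Riesz])
  qed
  show ?thesis
    using left right Riesz_basis_weight_SN[of \<Psi> m] Riesz_basis_SN_weight[of m \<Psi>]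
      Riesz_basis_weight_cases[of m \<Psi>, OF _ m_nonzero] right_inverse left_inverse
    by blast
qed

end
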